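(* For $n\ge1$ and $\theta>0$ let $\Xi_{n,\theta}$ be the law of $(P_1(\theta),\ldots,P_n(\theta))$ on the space $\nabla_n=\{(p_1,\ldots,p_n):0\le p_n\le\cdots\le p_1,\ \sum_{k=1}^np_k\le1\}$. For every fixed $n\ge2$, the family $\{\Xi_{n,\theta}:\theta>0\}$ satisfies a large deviation principle on $\nabla_n$ (as $\theta\to\infty$) with speed $\theta$ and rate function $$S_n(p_1,\ldots,p_n)=\begin{cases}\log\dfrac{1}{1-\sum_{k=1}^np_k}, & (p_1,\ldots,p_n)\in\nabla_n,\ \sum_{k=1}^np_k<1,\\ \infty, & \text{else.}\end{cases}$$
   Context: **Large deviation principle (LDP).** Let $E$ be a complete separable metric space. A family $\{Q_\theta:\theta>0\}$ of probability measures on $E$ satisfies an LDP (as $\theta\to\infty$) with speed $\theta$ and rate function $I:E\to[0,\infty]$ if for every closed $F\subset E$ and every open $G\subset E$, $\limsup_{\theta\to\infty}\frac1\theta\log Q_\theta\{F\}\le-\inf_{x\in F}I(x)$ and $\liminf_{\theta\to\infty}\frac1\theta\log Q_\theta\{G\}\ge-\inf_{x\in G}I(x)$, and for every $c>0$ the set $\{x:I(x)\le c\}$ is compact. (Conventions: $\log 0=-\infty$, $\inf\emptyset=\infty$.) **The Poisson–Dirichlet distribution.** For $\theta>0$, let $U_1,U_2,\ldots$ be i.i.d. with $Beta(1,\theta)$ distribution (density $\theta(1-x)^{\theta-1}$ on $(0,1)$). Put $X_1=U_1$ and $X_k=(1-U_1)\cdots(1-U_{k-1})U_k$ for $k\ge2$.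 Let $P_k(\theta)$ be the $k$th largest among $X_1,X_2,\ldots$, i.e. $\mathbf{P}(\theta)=(P_1(\theta),P_2(\theta),\ldots)$ is the sequence $(X_k)$ rearranged in descending order. The law of $\mathbf{P}(\theta)$ is the Poisson–Dirichlet distribution $PD(\theta)$. The space $\nabla_n$ carries the subspace topology of $\mathbb{R}^n$. *)

theory Defs
  imports "HOL-Probability.Probability"
begin

section \<open>Large deviation principles\<close>

definition log_prob :: "real \<Rightarrow> ereal" where
  "log_prob x = (if x = 0 then -\<infinity> else ereal (ln x))"

text \<open>
  The ambient type is a separable metric space, so a complete subset \<open>E\<close> is a complete separable
  metric space. The relatively closed and open subsets of \<open>E\<close> are those of \<^term>\<open>top_of_set E\<close>.
  In \<^typ>\<open>ereal\<close> an infimum over the empty set is \<open>\<infinity>\<close>.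
\<close>

definition satisfies_LDP ::
  "'a :: {metric_space, second_countable_topology} set \<Rightarrow> (real \<Rightarrow> 'a measure) \<Rightarrow> ('a \<Rightarrow> ereal) \<Rightarrow> bool"
where
  "satisfies_LDP E Q I \<longleftrightarrow>
     Topological_Spaces.complete E \<and>
     (\<forall>\<theta>>0. prob_space (Q \<theta>) \<and> space (Q \<theta>) = E \<and> sets (Q \<theta>) = sets (restrict_space borel E)) \<and>
     (\<forall>x\<in>E. 0 \<le> I x) \<and>
     (\<forall>F. closedin (top_of_set E) F \<longrightarrow>
        Limsup at_top (\<lambda>\<theta>. ereal (1 / \<theta>) * log_prob (measure (Q \<theta>) F)) \<le> - (INF x\<in>F. I x)) \<and>
     (\<forall>G. openin (top_of_set E) G \<longrightarrow>
        Liminf at_top (\<lambda>\<theta>. ereal (1 / \<theta>) * log_prob (measure (Q \<theta>) G)) \<ge> - (INF x\<in>G. I x)) \<and>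
     (\<forall>c::real. c > 0 \<longrightarrow> compact {x \<in> E. I x \<le> ereal c})"


section \<open>The Poisson--Dirichlet distribution\<close>

text \<open>All sequences are indexed from 0, so index \<open>k\<close> here is index \<open>k + 1\<close> in the usual notation.\<close>

definition beta1_density :: "real \<Rightarrow> real \<Rightarrow> real" where
  "beta1_density \<theta> x = (if 0 < x \<and> x < 1 then \<theta> * (1 - x) powr (\<theta> - 1) else 0)"

definition stick_breaking :: "(nat \<Rightarrow> real) \<Rightarrow> nat \<Rightarrow> real" where
  "stick_breaking u k = (\<Prod>j<k. 1 - u j) * u k"

text \<open>
  The \<open>k\<close>-th largest entry counts multiplicities: at most \<open>k\<close> entries exceed it and more than \<open>k\<close>
  entries are at least as large. It exists for every sequence of positive numbers tending to 0,
  hence almost surely for the sequences to which it is applied below. The lemma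
  \<open>kth_largest_rearrangement\<close> identifies it with the entry at position \<open>k\<close> of the rearrangement in
  descending order.
\<close>

definition is_kth_largest :: "(nat \<Rightarrow> real) \<Rightarrow> nat \<Rightarrow> real \<Rightarrow> bool" where
  "is_kth_largest x k v \<longleftrightarrow>
     finite {i. x i > v} \<and> card {i. x i > v} \<le> k \<and>
     (infinite {i. x i \<ge> v} \<or> card {i. x i \<ge> v} > k)"

definition kth_largest :: "(nat \<Rightarrow> real) \<Rightarrow> nat \<Rightarrow> real" where
  "kth_largest x k = (THE v. is_kth_largest x k v)"

lemma is_kth_largest_unique:
  assumes "is_kth_largest x k v" "is_kth_largest x k w"
  shows "v = w"
proof -
  have False if "is_kth_largest x k v" "is_kth_largest x k w" "v < w" for v w
  proof -
    have sub: "{i. x i \<ge> w} \<subseteq> {i. x i > v}"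
      using that(3) by auto
    have fin: "finite {i. x i > v}" and le: "card {i. x i > v} \<le> k"
      using that(1) by (auto simp: is_kth_largest_def)
    have "card {i. x i \<ge> w} > k"
      using that(2) finite_subset[OF sub fin] by (auto simp: is_kth_largest_def)
    with card_mono[OF fin sub] le show False by simp
  qed
  with assms show ?thesis
    by (meson linorder_neqE_linordered_idom)
qed

lemma kth_largest_rearrangement:
  assumes "bij \<sigma>" and "antimono (x \<circ> \<sigma>)"
  shows "kth_largest x k = x (\<sigma> k)"
proof -
  have surj: "\<exists>j. i = \<sigma> j" for i
    using assms(1) by (meson bij_pointE)
  have inj: "inj_on \<sigma> A" for A
    using assms(1) by (meson bij_is_inj inj_on_subset subset_UNIV)
  have mono: "x (\<sigma> j) \<le> x (\<sigma> i)" if "i \<le> j" for i j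
    using antimonoD[OF assms(2) that] by simp
  have gt: "{i. x i > x (\<sigma> k)} \<subseteq> \<sigma> ` {..<k}"
  proof
    fix i assume i: "i \<in> {i. x i > x (\<sigma> k)}"
    obtain j where j: "i = \<sigma> j" using surj by blast
    have "j < k" using i mono[of k j] unfolding j by (auto simp: not_le[symmetric])
    then show "i \<in> \<sigma> ` {..<k}" using j by auto
  qed
  have ge: "\<sigma> ` {..k} \<subseteq> {i. x i \<ge> x (\<sigma> k)}"
    using mono by auto
  have "finite {i. x i > x (\<sigma> k)}"
    using gt finite_subset by blast
  moreover have "card {i. x i > x (\<sigma> k)} \<le> k"
    using card_mono[OF _ gt] by (simp add: card_image[OF inj])
  moreover have "card {i. x i \<ge> x (\<sigma> k)} > k" if "finite {i. x i \<ge> x (\<sigma> k)}"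
    using card_mono[OF that ge] by (simp add: card_image[OF inj])
  ultimately have "is_kth_largest x k (x (\<sigma> k))"
    by (auto simp: is_kth_largest_def)
  then show ?thesis
    unfolding kth_largest_def by (blast intro: the_equality is_kth_largest_unique)
qed

text \<open>
  As in \<^term>\<open>Euclidean_space n\<close>, a point of \<open>\<real>\<^sup>n\<close> is a function on \<^typ>\<open>nat\<close> that vanishes from
  index \<open>n\<close> on.
\<close>

definition nabla :: "nat \<Rightarrow> (nat \<Rightarrow> real) set" where
  "nabla n = {p. (\<forall>i\<ge>n. p i = 0) \<and> (\<forall>i<n. 0 \<le> p i) \<and>
                 (\<forall>i j. i \<le> j \<longrightarrow> j < n \<longrightarrow> p j \<le> p i) \<and> (\<Sum>i<n. p i) \<le> 1}"

lemma top_of_set_nabla: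
  "top_of_set (nabla n) = subtopology (Euclidean_space n) (nabla n)"
proof -
  have "{x. \<forall>i\<ge>n. x i = 0} \<inter> nabla n = nabla n"
    by (auto simp: nabla_def)
  then show ?thesis
    by (simp add: Euclidean_space_def subtopology_subtopology euclidean_product_topology)
qed

definition top_PD :: "nat \<Rightarrow> (nat \<Rightarrow> real) \<Rightarrow> nat \<Rightarrow> real" where
  "top_PD n u = (\<lambda>i. if i < n then kth_largest (stick_breaking u) i else 0)"

text \<open>
  The law of the \<open>n\<close> largest entries as a measure on \<^term>\<open>nabla n\<close>, for stick-breaking proportions
  \<open>U\<close> on the probability space \<open>M\<close>. The law is restricted to \<^term>\<open>nabla n\<close> because the point
  lies there only almost surely.
\<close>

definition Xi :: "nat \<Rightarrow> 'w measure \<Rightarrow> (nat \<Rightarrow> 'w \<Rightarrow> real) \<Rightarrow> (nat \<Rightarrow> real) measure" where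
  "Xi n M U = restrict_space (distr M borel (\<lambda>\<omega>. top_PD n (\<lambda>j. U j \<omega>))) (nabla n)"

definition rate_S :: "nat \<Rightarrow> (nat \<Rightarrow> real) \<Rightarrow> ereal" where
  "rate_S n p = (if p \<in> nabla n \<and> (\<Sum>i<n. p i) < 1
                 then ereal (ln (1 / (1 - (\<Sum>i<n. p i)))) else \<infinity>)"

end

theory Submission
  imports Defs
begin

text \<open>
  Write \<open>X\<^sub>i\<close> for the pieces of the broken stick, \<open>P\<^sub>1 \<ge> \<dots> \<ge> P\<^sub>n\<close> for the \<open>n\<close> largest pieces and
  \<open>V\<^sub>i = 1 - U\<^sub>i\<close>. The variables \<open>V\<^sub>i\<close> are independent with density \<open>\<theta> v\<^bsup>\<theta> - 1\<^esup>\<close> on \<open>(0, 1)\<close>, so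
  that \<open>V\<^sub>i \<le> v\<close> has probability \<open>v\<^bsup>\<theta>\<^esup>\<close> and all moments are explicit. The rate function depends on
  a point only through its sum. Hence the theorem says that, up to subexponential factors, a closed
  event has probability at most \<open>(1 - s)\<^bsup>\<theta>\<^esup>\<close> and an open event at least that, where \<open>s\<close> is the
  infimum of the sums of its points.

  Upper bound. For a finite set \<open>I\<close> of indices the pieces satisfy
  \<open>(\<Sum>i\<in>I. X\<^sub>i) \<le> 1 - (\<Prod>i\<in>I. V\<^sub>i)\<close> (\<open>stick_breaking_sum_le\<close>), because omitted steps can only
  shorten the later pieces. Markov's inequality for the moment of order \<open>1 - \<theta>\<close> bounds the
  probability that the product of \<open>n\<close> of the \<open>V\<^sub>i\<close> is at most \<open>t\<close> by \<open>\<theta>\<^bsup>n\<^esup> t\<^bsup>\<theta> - 1\<^esup>\<close>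
  (\<open>prob_prod_le\<close>). The \<open>n\<close> largest pieces may sit anywhere, which would need a union bound over
  infinitely many index sets. All pieces from index \<open>K\<close> on add up to at most \<open>\<Prod>j<K. V\<^sub>j\<close>, however,
  and the moment of order \<open>\<theta>\<close>, which is \<open>1 / 2\<close>, shows that for \<open>K\<close> proportional to \<open>\<theta>\<close> this product
  is small except with probability below any prescribed exponential rate
  (\<open>prob_prod_ge\<close>). What remains is a union over at most \<open>K\<^bsup>n\<^esup>\<close> sets, a polynomial number
  (\<open>prob_sum_largest_ge\<close>).

  Lower bound. Given \<open>p\<close> with \<open>(\<Sum>i<n. p\<^sub>i) < 1\<close>, let the first \<open>n\<close> breaks reproduce \<open>p\<close> in order: ask that
  \<open>U\<^sub>j\<close> lies just above the proportion \<open>q\<^sub>j\<close> that cuts off \<open>p\<^sub>j\<close>. This has probability about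
  \<open>(\<Prod>j<n. 1 - q\<^sub>j)\<^bsup>\<theta>\<^esup> = (1 - (\<Sum>i<n. p\<^sub>i))\<^bsup>\<theta>\<^esup>\<close>. Independently, all further pieces
  are small with probability tending to 1 (\<open>prob_tail_small\<close>). Since ordering is a contraction for
  the supremum distance (\<open>kth_largest_close\<close>), the \<open>n\<close> largest pieces are then close to \<open>p\<close>, even
  if \<open>p\<close> has ties or zeros (\<open>prob_largest_close\<close>).
\<close>

section \<open>Partial sums of a broken stick\<close>

lemma stick_breaking_sum: "(\<Sum>i<N. stick_breaking u i) = 1 - (\<Prod>i<N. 1 - u i)"
  by (induction N) (simp_all add: stick_breaking_def algebra_simps)

context
  fixes u :: "nat \<Rightarrow> real"
  assumes u: "\<And>j. u j \<in> {0<..<1}"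
begin

lemma one_minus_bounds: "0 < 1 - u j" "1 - u j < 1"
  using u[of j] by auto

lemma prod_one_minus_bounds: "0 < (\<Prod>i\<in>A. 1 - u i)" "(\<Prod>i\<in>A. 1 - u i) \<le> 1"
  using one_minus_bounds by (intro prod_pos prod_le_1; simp add: less_imp_le)+

lemma stick_breaking_pos: "0 < stick_breaking u i"
  unfolding stick_breaking_def using prod_one_minus_bounds(1) u[of i] by simp

lemma prod_one_minus_antimono:
  assumes "finite B" "A \<subseteq> B"
  shows "(\<Prod>i\<in>B. 1 - u i) \<le> (\<Prod>i\<in>A. 1 - u i)"
proof -
  have "(\<Prod>i\<in>B. 1 - u i) = (\<Prod>i\<in>B - A. 1 - u i) * (\<Prod>i\<in>A. 1 - u i)"
    by (rule prod.subset_diff[OF assms(2,1)])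
  also have "\<dots> \<le> 1 * (\<Prod>i\<in>A. 1 - u i)"
    using prod_one_minus_bounds by (intro mult_right_mono) (auto intro: less_imp_le)
  finally show ?thesis by simp
qed

text \<open>
  Induction on the largest index \<open>b\<close>: the piece \<open>b\<close> is a fraction \<open>u b\<close> of what is left of the
  stick after all breaks before \<open>b\<close>, and this is at most what would be left if only those of these
  breaks whose index is in \<open>I\<close> had taken place.
\<close>

lemma stick_breaking_sum_le:
  assumes "finite I"
  shows "(\<Sum>i\<in>I. stick_breaking u i) \<le> 1 - (\<Prod>i\<in>I. 1 - u i)"
  using assms
proof (induction I rule: finite_linorder_max_induct)
  case (insert b A)
  have b: "b \<notin> A" using insert.hyps(2) by auto
  have "(\<Prod>j<b. 1 - u j) * u b \<le> (\<Prod>i\<in>A. 1 - u i) * u b"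
    using insert.hyps u[of b] by (intro mult_right_mono prod_one_minus_antimono) auto
  then show ?case
    using insert b by (simp add: stick_breaking_def algebra_simps)
qed simp

text \<open>
  All pieces from index \<open>K\<close> on are cut from the remainder after \<open>K\<close> breaks.
\<close>

lemma stick_breaking_tail_sum_le:
  assumes "finite J" "J \<subseteq> {K..}"
  shows "(\<Sum>i\<in>J. stick_breaking u i) \<le> (\<Prod>j<K. 1 - u j)"
proof -
  obtain N where N: "J \<subseteq> {..<N}" "K \<le> N"
    using finite_nat_bounded[OF assms(1)]
    by (metis lessThan_subset_iff nat_le_linear subset_trans)
  have "(\<Sum>i\<in>J. stick_breaking u i) \<le> (\<Sum>i\<in>{..<N} - {..<K}. stick_breaking u i)"
    using assms N stick_breaking_pos by (intro sum_mono2) (auto intro: less_imp_le)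
  also have "\<dots> = (\<Prod>i<K. 1 - u i) - (\<Prod>i<N. 1 - u i)"
    using N by (subst sum_diff) (auto simp: stick_breaking_sum)
  also have "\<dots> \<le> (\<Prod>i<K. 1 - u i)"
    using prod_one_minus_bounds(1)[of "{..<N}"] by simp
  finally show ?thesis .
qed

lemma stick_breaking_sum_le_one: "finite I \<Longrightarrow> (\<Sum>i\<in>I. stick_breaking u i) \<le> 1"
  using stick_breaking_tail_sum_le[of I 0] by simp

lemma finite_superlevel_stick_breaking:
  assumes "c > 0"
  shows "finite {i. stick_breaking u i \<ge> c}"
proof (rule ccontr)
  assume "infinite {i. stick_breaking u i \<ge> c}"
  then obtain B where B: "B \<subseteq> {i. stick_breaking u i \<ge> c}" "finite B" "card B = Suc (nat \<lfloor>1 / c\<rfloor>)"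
    using infinite_arbitrarily_large by blast
  have "1 < real (card B) * c"
  proof -
    have "1 / c < real (card B)" unfolding B(3) by linarith
    then show ?thesis using assms by (simp add: field_simps)
  qed
  also have "\<dots> \<le> (\<Sum>i\<in>B. stick_breaking u i)"
    using B by (intro sum_bounded_below) auto
  also have "\<dots> \<le> 1"
    by (rule stick_breaking_sum_le_one) fact
  finally show False by simp
qed


section \<open>The largest pieces\<close>

text \<open>
  The largest pieces are picked one after the other. Each choice is possible because only finitely
  many pieces are at least as long as a given one. The property is phrased by comparison with every
  index that has not been chosen before, which yields both the monotonicity and the ranking of the
  chosen pieces.
\<close>

lemma greedy_selection:
  fixes n :: nat
  shows "\<exists>\<sigma>. inj_on \<sigma> {..<n} \<and>
     (\<forall>k<n. \<forall>j. j \<notin> \<sigma> ` {..<k} \<longrightarrow> stick_breaking u j \<le> stick_breaking u (\<sigma> k))"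
proof (induction n)
  case (Suc n)
  then obtain \<sigma> where inj: "inj_on \<sigma> {..<n}"
    and max: "\<forall>k<n. \<forall>j. j \<notin> \<sigma> ` {..<k} \<longrightarrow> stick_breaking u j \<le> stick_breaking u (\<sigma> k)"
    by (elim exE conjE)
  let ?x = "stick_breaking u"
  obtain j0 where j0: "j0 \<notin> \<sigma> ` {..<n}"
    using ex_new_if_finite[OF infinite_UNIV_nat, of "\<sigma> ` {..<n}"] by blast
  define C where "C = {j. ?x j \<ge> ?x j0} - \<sigma> ` {..<n}"
  have C: "finite C" "j0 \<in> C"
    using finite_superlevel_stick_breaking[OF stick_breaking_pos, of j0] j0 by (auto simp: C_def)
  obtain i where i: "i \<in> C" "\<And>j. j \<in> C \<Longrightarrow> ?x j \<le> ?x i"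
    using ex_is_arg_min_if_finite[of C "\<lambda>j. - ?x j"] C by (auto simp: is_arg_min_linorder)
  have i_max: "?x j \<le> ?x i" if "j \<notin> \<sigma> ` {..<n}" for j
    using i(2)[of j] i(2)[OF C(2)] that by (cases "j \<in> C") (auto simp: C_def)
  have img: "(\<sigma>(n := i)) ` {..<k} = \<sigma> ` {..<k}" if "k \<le> n" for k
    using that by (intro image_cong) auto
  show ?case
  proof (intro exI[of _ "\<sigma>(n := i)"] conjI allI impI)
    show "inj_on (\<sigma>(n := i)) {..<Suc n}"
      using inj i(1) by (auto simp: lessThan_Suc inj_on_def C_def)
    fix k j assume "k < Suc n" "j \<notin> (\<sigma>(n := i)) ` {..<k}"
    then show "?x j \<le> ?x ((\<sigma>(n := i)) k)"
      using max i_max[of j] img[of k] by (cases "k = n") auto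
  qed
qed simp

lemma kth_largest_selection:
  fixes n :: nat
  shows "\<exists>\<sigma>. inj_on \<sigma> {..<n} \<and>
    (\<forall>k<n. is_kth_largest (stick_breaking u) k (stick_breaking u (\<sigma> k))) \<and>
    (\<forall>k<n. \<forall>j\<le>k. stick_breaking u (\<sigma> k) \<le> stick_breaking u (\<sigma> j))"
proof -
  let ?x = "stick_breaking u"
  obtain \<sigma> where inj: "inj_on \<sigma> {..<n}"
    and max': "\<forall>k<n. \<forall>j. j \<notin> \<sigma> ` {..<k} \<longrightarrow> ?x j \<le> ?x (\<sigma> k)"
    using greedy_selection[of n] by (elim exE conjE)
  then have max: "?x j \<le> ?x (\<sigma> k)" if "k < n" "j \<notin> \<sigma> ` {..<k}" for k j
    using that by simp
  have inj': "inj_on \<sigma> A" if "A \<subseteq> {..<n}" for A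
    using inj that by (rule inj_on_subset)
  have anti: "?x (\<sigma> k) \<le> ?x (\<sigma> j)" if "j \<le> k" "k < n" for j k
    using that inj by (intro max) (force simp: inj_on_def)+
  have "is_kth_largest ?x k (?x (\<sigma> k))" if k: "k < n" for k
  proof -
    have gt: "{i. ?x i > ?x (\<sigma> k)} \<subseteq> \<sigma> ` {..<k}"
      using max[OF k] by force
    have ge: "\<sigma> ` {..k} \<subseteq> {i. ?x i \<ge> ?x (\<sigma> k)}"
      using anti k by auto
    have "card {i. ?x i > ?x (\<sigma> k)} \<le> k"
      using card_mono[OF _ gt] k by (simp add: card_image[OF inj'])
    moreover have "card {i. ?x i \<ge> ?x (\<sigma> k)} > k" if "finite {i. ?x i \<ge> ?x (\<sigma> k)}"
      using card_mono[OF that ge] k by (simp add: card_image[OF inj'] subset_eq)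
    ultimately show ?thesis
      using finite_subset[OF gt] by (auto simp: is_kth_largest_def)
  qed
  with inj anti show ?thesis
    by (intro exI[of _ \<sigma>] conjI allI impI)
qed

lemma is_kth_largest_kth_largest:
  "is_kth_largest (stick_breaking u) k (kth_largest (stick_breaking u) k)"
proof -
  obtain \<sigma> where
    "\<forall>j<Suc k. is_kth_largest (stick_breaking u) j (stick_breaking u (\<sigma> j))"
    using kth_largest_selection[of "Suc k"] by (elim exE conjE)
  then have v: "is_kth_largest (stick_breaking u) k (stick_breaking u (\<sigma> k))"
    by simp
  show ?thesis
    unfolding kth_largest_def
  proof (rule theI)
    show "is_kth_largest (stick_breaking u) k (stick_breaking u (\<sigma> k))" by (rule v)
    show "w = stick_breaking u (\<sigma> k)" if "is_kth_largest (stick_breaking u) k w" for w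
      using that v by (rule is_kth_largest_unique)
  qed
qed

lemma top_PD_selection:
  "\<exists>\<sigma>. inj_on \<sigma> {..<n} \<and> (\<forall>k<n. top_PD n u k = stick_breaking u (\<sigma> k)) \<and>
    (\<forall>k<n. \<forall>j\<le>k. stick_breaking u (\<sigma> k) \<le> stick_breaking u (\<sigma> j))"
proof -
  have eq: "top_PD n u k = v" if "k < n" "is_kth_largest (stick_breaking u) k v" for k v
    using is_kth_largest_unique[OF is_kth_largest_kth_largest that(2)] that(1)
    by (simp add: top_PD_def)
  obtain \<sigma> where "inj_on \<sigma> {..<n}"
    "\<forall>k<n. is_kth_largest (stick_breaking u) k (stick_breaking u (\<sigma> k))"
    "\<forall>k<n. \<forall>j\<le>k. stick_breaking u (\<sigma> k) \<le> stick_breaking u (\<sigma> j)"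
    using kth_largest_selection[of n] by (elim exE conjE)
  with eq show ?thesis
    by (intro exI[of _ \<sigma>]) simp
qed

lemma top_PD_in_nabla: "top_PD n u \<in> nabla n"
proof -
  obtain \<sigma> where \<sigma>: "inj_on \<sigma> {..<n}" "\<forall>k<n. top_PD n u k = stick_breaking u (\<sigma> k)"
    "\<forall>k<n. \<forall>j\<le>k. stick_breaking u (\<sigma> k) \<le> stick_breaking u (\<sigma> j)"
    using top_PD_selection[of n] by (elim exE conjE)
  have "(\<Sum>i<n. top_PD n u i) = (\<Sum>i\<in>\<sigma> ` {..<n}. stick_breaking u i)"
    using \<sigma> by (simp add: sum.reindex)
  also have "\<dots> \<le> 1"
    by (rule stick_breaking_sum_le_one) simp
  finally show ?thesis
    using \<sigma> stick_breaking_pos by (auto simp: nabla_def top_PD_def less_imp_le)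
qed

text \<open>
  This reduces the event that the \<open>n\<close> largest pieces have a large sum to events about \<open>n\<close> breaks
  among the first \<open>K\<close>. The ranked pieces with index below \<open>K\<close> may be fewer than \<open>n\<close>; enlarging their
  index set to exactly \<open>n\<close> elements only increases the sum and makes the number of possible sets a
  binomial coefficient.
\<close>

lemma top_PD_sum_le:
  assumes "n \<le> K"
  obtains I where "I \<subseteq> {..<K}" "card I = n"
    "(\<Sum>i<n. top_PD n u i) \<le> 1 - (\<Prod>i\<in>I. 1 - u i) + (\<Prod>j<K. 1 - u j)"
proof -
  let ?x = "stick_breaking u"
  obtain \<sigma> where \<sigma>: "inj_on \<sigma> {..<n}" "\<forall>k<n. top_PD n u k = ?x (\<sigma> k)"
    using top_PD_selection[of n] by (elim exE conjE)
  define J where "J = \<sigma> ` {..<n}"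
  have J: "finite J" "card J = n"
    using \<sigma>(1) by (auto simp: J_def card_image)
  have "J \<inter> {..<K} \<subseteq> {..<K}" "card (J \<inter> {..<K}) \<le> n"
    using J card_mono[of J "J \<inter> {..<K}"] by auto
  then obtain I where I: "J \<inter> {..<K} \<subseteq> I" "I \<subseteq> {..<K}" "card I = n"
    using exists_subset_between[of "J \<inter> {..<K}" n "{..<K}"] assms by auto
  have fin: "finite I" using I(2) finite_subset by blast
  have "(\<Sum>i<n. top_PD n u i) = (\<Sum>i\<in>J. ?x i)"
    using \<sigma> by (simp add: J_def sum.reindex)
  also have "\<dots> = (\<Sum>i\<in>J \<inter> {..<K}. ?x i) + (\<Sum>i\<in>J - {..<K}. ?x i)"
    by (rule sum.Int_Diff[OF J(1)])
  also have "\<dots> \<le> (\<Sum>i\<in>I. ?x i) + (\<Prod>j<K. 1 - u j)"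
    using I fin J stick_breaking_pos
    by (intro add_mono sum_mono2 stick_breaking_tail_sum_le) (auto intro: less_imp_le)
  also have "\<dots> \<le> 1 - (\<Prod>i\<in>I. 1 - u i) + (\<Prod>j<K. 1 - u j)"
    using stick_breaking_sum_le[OF fin] by simp
  finally show thesis using that I by blast
qed


section \<open>Stability of the largest pieces\<close>

lemma stick_breaking_le: "stick_breaking u k \<le> (\<Prod>j\<in>A. 1 - u j)" if "A \<subseteq> {..<k}"
proof -
  have "stick_breaking u k \<le> (\<Prod>j<k. 1 - u j) * 1"
    unfolding stick_breaking_def using u[of k] prod_one_minus_bounds
    by (intro mult_left_mono) (auto intro: less_imp_le)
  then show ?thesis using prod_one_minus_antimono[OF _ that] by simp
qed

lemma stick_breaking_le_self: "stick_breaking u k \<le> u k"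
  unfolding stick_breaking_def using u[of k] prod_one_minus_bounds(2)[of "{..<k}"]
  by (simp add: mult_le_cancel_right1)

end

text \<open>
  Ranking is 1-Lipschitz for the supremum distance. At most \<open>k\<close> entries of \<open>x\<close> exceed \<open>v\<close>, so some
  entry with index at most \<open>k\<close> does not, and \<open>p\<close> is at least \<open>p k\<close> there; at least \<open>k + 1\<close> entries
  reach \<open>v\<close>, so one with index at least \<open>k\<close> does, and \<open>p\<close> is at most \<open>p k\<close> there.
\<close>

lemma kth_largest_close:
  assumes v: "is_kth_largest x k v"
    and close: "\<And>i. \<bar>x i - p i\<bar> \<le> \<delta>" and anti: "\<And>i j. i \<le> j \<Longrightarrow> p j \<le> p i"
  shows "\<bar>v - p k\<bar> \<le> \<delta>"
proof -
  have "\<not> {..k} \<subseteq> {i. x i > v}"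
    using v card_mono[of "{i. x i > v}" "{..k}"] by (auto simp: is_kth_largest_def)
  then obtain i where "i \<in> {..k}" "i \<notin> {i. x i > v}" by blast
  then have i: "i \<le> k" "x i \<le> v" by auto
  have "\<not> {i. x i \<ge> v} \<subseteq> {..<k}"
    using v card_mono[of "{..<k}" "{i. x i \<ge> v}"] finite_subset[of "{i. x i \<ge> v}" "{..<k}"]
    by (auto simp: is_kth_largest_def)
  then obtain j where "j \<in> {i. x i \<ge> v}" "j \<notin> {..<k}" by blast
  then have j: "k \<le> j" "v \<le> x j" by auto
  show ?thesis
    using i j close[of i] close[of j] anti[OF i(1)] anti[OF j(1)] by linarith
qed

text \<open>
  The proportion of the remaining stick that has to be cut off at step \<open>j\<close> to obtain the piece
  \<open>p j\<close>.
\<close>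

definition breaking_proportion :: "(nat \<Rightarrow> real) \<Rightarrow> nat \<Rightarrow> real" where
  "breaking_proportion p j = p j / (1 - (\<Sum>i<j. p i))"

lemma nabla_partial_sum_less_one:
  assumes "p \<in> nabla n" "(\<Sum>i<n. p i) < 1"
  shows "(\<Sum>i<j. p i) < 1"
proof -
  have nonneg: "0 \<le> p i" for i
    using assms(1) by (cases "i < n") (auto simp: nabla_def)
  have "(\<Sum>i<j. p i) \<le> (\<Sum>i<max j n. p i)"
    using nonneg by (intro sum_mono2) auto
  also have "\<dots> = (\<Sum>i<n. p i)"
    using assms(1) by (intro sum.mono_neutral_right) (auto simp: nabla_def)
  finally show ?thesis using assms(2) by simp
qed

lemma prod_breaking_proportion:
  assumes "p \<in> nabla n" "(\<Sum>i<n. p i) < 1"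
  shows "(\<Prod>i<j. 1 - breaking_proportion p i) = 1 - (\<Sum>i<j. p i)"
proof (induction j)
  case (Suc j)
  have "(\<Prod>i<Suc j. 1 - breaking_proportion p i)
      = (1 - (\<Sum>i<j. p i)) * (1 - p j / (1 - (\<Sum>i<j. p i)))"
    using Suc by (simp add: breaking_proportion_def)
  also have "\<dots> = 1 - (\<Sum>i<Suc j. p i)"
    using nabla_partial_sum_less_one[OF assms, of j] by (simp add: field_simps)
  finally show ?case .
qed simp

lemma breaking_proportion_bounds:
  assumes "p \<in> nabla n" "(\<Sum>i<n. p i) < 1"
  shows "0 \<le> breaking_proportion p j" "breaking_proportion p j < 1"
proof -
  have "0 \<le> p j"
    using assms(1) by (cases "j < n") (auto simp: nabla_def)
  then show "0 \<le> breaking_proportion p j" "breaking_proportion p j < 1"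
    using nabla_partial_sum_less_one[OF assms, of j] nabla_partial_sum_less_one[OF assms, of "Suc j"]
    by (simp_all add: breaking_proportion_def field_simps)
qed

lemma stick_breaking_close:
  assumes "\<And>j. j \<le> i \<Longrightarrow> u j \<in> {0..1}" "\<And>j. j \<le> i \<Longrightarrow> q j \<in> {0..1}"
    and "\<And>j. j \<le> i \<Longrightarrow> \<bar>u j - q j\<bar> \<le> h"
  shows "\<bar>stick_breaking u i - stick_breaking q i\<bar> \<le> real (Suc i) * h"
proof -
  \<comment> \<open>Read as one product, a piece is 1-Lipschitz in each factor.\<close>
  let ?f = "\<lambda>u j. if j < i then 1 - u j else (u j :: real)"
  have eq: "stick_breaking u i = (\<Prod>j<Suc i. ?f u j)" for u
    by (simp add: stick_breaking_def)
  have "norm ((\<Prod>j<Suc i. ?f u j) - (\<Prod>j<Suc i. ?f q j)) \<le> (\<Sum>j<Suc i. norm (?f u j - ?f q j))"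
    using assms(1,2) by (intro norm_prod_diff) (auto simp: less_Suc_eq_le)
  also have "\<dots> \<le> (\<Sum>j<Suc i. h)"
    using assms(3) by (intro sum_mono) (auto simp: less_Suc_eq_le abs_minus_commute)
  finally show ?thesis by (simp add: eq)
qed

text \<open>
  The first \<open>n\<close> pieces approximate \<open>p\<close>. The later ones are at most \<open>\<delta>\<close>, for different reasons: below
  index \<open>L\<close> the break itself is at most \<open>\<delta>\<close>, and from \<open>L\<close> on so is the rest of the stick.
\<close>

lemma top_PD_close:
  assumes u: "\<And>j. u j \<in> {0<..<1}"
    and p: "p \<in> nabla n" "(\<Sum>i<n. p i) < 1"
    and first: "\<And>j. j < n \<Longrightarrow> \<bar>u j - breaking_proportion p j\<bar> \<le> \<delta> / n"
    and rest: "\<And>k. k \<in> {n..<L} \<Longrightarrow> u k \<le> \<delta>" "(\<Prod>j\<in>{n..<L}. 1 - u j) \<le> \<delta>"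
  shows "\<bar>top_PD n u i - p i\<bar> \<le> \<delta>"
proof (cases "i < n")
  case i: True
  have \<delta>: "0 \<le> \<delta>" 
    using prod_one_minus_bounds(1)[of u "{n..<L}", OF u] rest(2) by linarith
  have close: "\<bar>stick_breaking u k - p k\<bar> \<le> \<delta>" for k
  proof (cases "k < n")
    case True
    have "stick_breaking (breaking_proportion p) k = p k"
      using nabla_partial_sum_less_one[OF p, of k]
      unfolding stick_breaking_def prod_breaking_proportion[OF p]
      by (simp add: breaking_proportion_def)
    moreover have "\<bar>stick_breaking u k - stick_breaking (breaking_proportion p) k\<bar> \<le> real (Suc k) * (\<delta> / n)"
      using True u first breaking_proportion_bounds[OF p]
      by (intro stick_breaking_close) (auto intro: less_imp_le)
    moreover have "real (Suc k) * (\<delta> / n) \<le> real n * (\<delta> / n)"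
      using True \<delta> by (intro mult_right_mono) auto
    ultimately show ?thesis using True by simp
  next
    case False
    have "stick_breaking u k \<le> \<delta>"
    proof (cases "k < L")
      case True
      then show ?thesis
        using stick_breaking_le_self[of u k, OF u] rest(1)[of k] False by simp
    next
      case False
      then show ?thesis
        using stick_breaking_le[of u "{n..<L}" k, OF u] rest(2) by fastforce
    qed
    moreover have "p k = 0" using False p(1) by (simp add: nabla_def)
    ultimately show ?thesis using stick_breaking_pos[of u k, OF u] by simp
  qed
  have anti: "p b \<le> p a" if "a \<le> b" for a b
    using p(1) that by (cases "b < n"; cases "a < n") (auto simp: nabla_def)
  show ?thesis
    using kth_largest_close[OF is_kth_largest_kth_largest[of u, OF u] close anti, of i] i
    by (simp add: top_PD_def)
next
  case False
  then show ?thesis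
    using prod_one_minus_bounds(1)[of u "{n..<L}", OF u] rest(2) p(1) by (simp add: top_PD_def nabla_def)
qed

section \<open>Measurability of the ranked pieces\<close>

text \<open>
  The ranking conditions become quantifications over the countably many finite sets of indices,
  from which measurability can be read off.
\<close>

lemma at_least_card_iff:
  "(infinite {i::nat. P i} \<or> card {i. P i} > k) \<longleftrightarrow> (\<exists>S\<in>{S. finite S \<and> card S = Suc k}. \<forall>i\<in>S. P i)"
proof
  assume *: "infinite {i. P i} \<or> card {i. P i} > k"
  show "\<exists>S\<in>{S. finite S \<and> card S = Suc k}. \<forall>i\<in>S. P i"
  proof (cases "finite {i. P i}")
    case True
    then obtain S where "S \<subseteq> {i. P i}" "card S = Suc k"
      using * obtain_subset_with_card_n[of "Suc k" "{i. P i}"] by auto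
    with True show ?thesis using finite_subset by blast
  next
    case False
    then obtain S where "S \<subseteq> {i. P i}" "finite S" "card S = Suc k"
      using infinite_arbitrarily_large by blast
    then show ?thesis by blast
  qed
next
  assume "\<exists>S\<in>{S. finite S \<and> card S = Suc k}. \<forall>i\<in>S. P i"
  then obtain S where S: "finite S" "card S = Suc k" "S \<subseteq> {i. P i}" by blast
  then show "infinite {i. P i} \<or> card {i. P i} > k"
    using card_mono[OF _ S(3)] by auto
qed



lemma countable_sets_of_card: "countable {S::nat set. finite S \<and> card S = m}"
  by (rule countable_subset[OF _ countable_Collect_finite]) auto

text \<open>
  A value of rank \<open>k\<close> is always one of the entries, because the number of entries above it differs
  from the number of entries not below it. Hence the definite description can be replaced by a
  search over the indices; where no value of rank \<open>k\<close> exists, it is a fixed number.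
\<close>

lemma kth_largest_eq:
  "kth_largest x k = (if \<exists>i. is_kth_largest x k (x i) then x (LEAST i. is_kth_largest x k (x i))
     else (THE v. False))"
proof (cases "\<exists>i. is_kth_largest x k (x i)")
  case True
  then have "is_kth_largest x k (x (LEAST i. is_kth_largest x k (x i)))"
    by (rule LeastI_ex)
  then show ?thesis
    using True unfolding kth_largest_def by (auto intro: the_equality is_kth_largest_unique)
next
  case False
  have "\<not> is_kth_largest x k v" for v
  proof
    assume v: "is_kth_largest x k v"
    have "{i. x i \<ge> v} \<noteq> {i. x i > v}"
      using v by (auto simp: is_kth_largest_def)
    then obtain i where "x i = v"
      by (metis (mono_tags, lifting) Collect_cong order_le_less)
    with v False show False by blast
  qed
  with False show ?thesis by (simp add: kth_largest_def)
qed

lemma measurable_kth_largest [measurable]: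
  assumes X [measurable]: "\<And>i. X i \<in> borel_measurable M"
  shows "(\<lambda>\<omega>. kth_largest (\<lambda>i. X i \<omega>) k) \<in> borel_measurable M"
proof -
  have count: "countable {S::nat set. finite S \<and> card S = Suc k}"
    by (rule countable_sets_of_card)
  have iff: "is_kth_largest x k v \<longleftrightarrow>
      \<not> (\<exists>S\<in>{S. finite S \<and> card S = Suc k}. \<forall>i\<in>S. x i > v) \<and>
      (\<exists>S\<in>{S. finite S \<and> card S = Suc k}. \<forall>i\<in>S. x i \<ge> v)" for x v
    unfolding is_kth_largest_def at_least_card_iff[symmetric] by auto
  have ex: "Measurable.pred M (\<lambda>\<omega>. \<exists>S\<in>{S. finite S \<and> card S = Suc k}. \<forall>i\<in>S. P i \<omega>)"
    if "\<And>i. Measurable.pred M (P i)" for P :: "nat \<Rightarrow> _"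
    unfolding pred_def using that
    by (intro sets.sets_Collect_countable_Ex' count) (auto simp: pred_def[symmetric] intro!: pred_intros_finite(3))
  have [measurable]: "Measurable.pred M (\<lambda>\<omega>. is_kth_largest (\<lambda>i. X i \<omega>) k (X j \<omega>))" for j
    unfolding iff
    by (intro pred_intros_logic ex) measurable
  show ?thesis
    unfolding kth_largest_eq by measurable
qed

lemma measurable_top_PD:
  assumes [measurable]: "\<And>i. X i \<in> borel_measurable M"
  shows "(\<lambda>\<omega>. top_PD n (\<lambda>i. X i \<omega>)) \<in> borel_measurable M"
proof (rule measurable_coordinatewise_then_product)
  fix i
  have [measurable]: "(\<lambda>\<omega>. stick_breaking (\<lambda>i. X i \<omega>) j) \<in> borel_measurable M" for j
    unfolding stick_breaking_def by measurable
  show "(\<lambda>\<omega>. top_PD n (\<lambda>i. X i \<omega>) i) \<in> borel_measurable M"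
    unfolding top_PD_def using measurable_kth_largest[of "\<lambda>j \<omega>. stick_breaking (\<lambda>i. X i \<omega>) j" M i]
    by (cases "i < n") simp_all
qed


section \<open>Topology of the ordered simplex\<close>

lemma compact_nabla_sum_le: "compact {p \<in> nabla n. (\<Sum>i<n. p i) \<le> c}"
proof -
  let ?box = "PiE UNIV (\<lambda>_::nat. {0..1::real})"
  have "compactin (product_topology (\<lambda>_. euclidean) UNIV) ?box"
    by (subst compactin_PiE) auto
  then have box: "compact ?box"
    by (simp add: euclidean_product_topology)
  have closed: "closed {p \<in> nabla n. (\<Sum>i<n. p i) \<le> c}"
    unfolding nabla_def mem_Collect_eq
    by (intro closed_Collect_conj closed_Collect_all closed_Collect_imp closed_Collect_le
          closed_Collect_eq open_Collect_const continuous_intros continuous_on_product_coordinates)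
  have "{p \<in> nabla n. (\<Sum>i<n. p i) \<le> c} \<subseteq> ?box"
  proof
    fix p assume p: "p \<in> {p \<in> nabla n. (\<Sum>i<n. p i) \<le> c}"
    have "p i \<in> {0..1}" for i
    proof (cases "i < n")
      case True
      then have "p i \<le> (\<Sum>i<n. p i)"
        using p by (intro member_le_sum) (auto simp: nabla_def)
      then show ?thesis using p True by (auto simp: nabla_def)
    next
      case False
      then show ?thesis using p by (auto simp: nabla_def)
    qed
    then show "p \<in> ?box" by auto
  qed
  then show ?thesis
    using compact_Int_closed[OF box closed] by (simp add: Int_absorb1)
qed

lemma compact_nabla: "compact (nabla n)"
proof -
  have "{p \<in> nabla n. (\<Sum>i<n. p i) \<le> 1} = nabla n" by (auto simp: nabla_def)
  then show ?thesis using compact_nabla_sum_le[of n 1] by simp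
qed

lemma nabla_in_borel [measurable]: "nabla n \<in> sets borel"
  by (intro borel_closed compact_imp_closed compact_nabla)

text \<open>
  In the product topology on sequences coordinatewise convergence is convergence, so a failing
  neighbourhood would give a sequence in \<^term>\<open>nabla n\<close> that converges to \<open>p\<close> outside the open set.
\<close>

lemma openin_nabla_contains_box:
  assumes G: "openin (top_of_set (nabla n)) G" and p: "p \<in> G"
  obtains \<delta> where "\<delta> > 0" "\<And>y. y \<in> nabla n \<Longrightarrow> (\<And>i. \<bar>y i - p i\<bar> \<le> \<delta>) \<Longrightarrow> y \<in> G"
proof -
  obtain T where T: "open T" "G = nabla n \<inter> T"
    using G by (auto simp: openin_open)
  have "\<exists>\<delta>>0. \<forall>y\<in>nabla n. (\<forall>i. \<bar>y i - p i\<bar> \<le> \<delta>) \<longrightarrow> y \<in> T"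
  proof (rule ccontr)
    assume *: "\<not> ?thesis"
    have "\<exists>y\<in>nabla n. (\<forall>i. \<bar>y i - p i\<bar> \<le> 1 / real (Suc m)) \<and> y \<notin> T" for m
      using * by (metis divide_pos_pos of_nat_0_less_iff zero_less_Suc zero_less_one)
    then obtain Y where Y: "\<And>m. Y m \<in> nabla n"
        "\<And>m i. \<bar>Y m i - p i\<bar> \<le> 1 / real (Suc m)" "\<And>m. Y m \<notin> T"
      by metis
    have "(\<lambda>m. Y m i) \<longlonglongrightarrow> p i" for i
    proof (rule LIM_zero_cancel, rule Lim_null_comparison)
      show "\<forall>\<^sub>F m in sequentially. norm (Y m i - p i) \<le> 1 / real (Suc m)"
        using Y(2) by simp
      show "(\<lambda>m. 1 / real (Suc m)) \<longlonglongrightarrow> 0" by (rule LIMSEQ_Suc[OF lim_1_over_n])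
    qed
    then have "limitin (product_topology (\<lambda>_. euclidean) UNIV) Y p sequentially"
      by (simp add: limitin_componentwise)
    then have "Y \<longlonglongrightarrow> p"
      by (simp add: euclidean_product_topology)
    then have "\<forall>\<^sub>F m in sequentially. Y m \<in> T"
      using T p by (auto intro: topological_tendstoD)
    then show False using Y(3) by (auto simp: eventually_sequentially)
  qed
  then show thesis using that T by blast
qed

section \<open>Independent beta variables\<close>

lemma has_integral_beta1_kernel:
  fixes s :: real
  assumes s: "s > 0" and ab: "0 \<le> a" "a \<le> b" "b \<le> 1"
  shows "((\<lambda>x. s * (1 - x) powr (s - 1)) has_integral (1 - a) powr s - (1 - b) powr s) {a..b}"
proof -
  have "((\<lambda>x. s * (1 - x) powr (s - 1)) has_integral - ((1 - b) powr s) - - ((1 - a) powr s)) {a..b}"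
  proof (rule fundamental_theorem_of_calculus_interior[OF ab(2)])
    show "continuous_on {a..b} (\<lambda>x. - ((1 - x) powr s))"
      using s ab by (intro continuous_intros continuous_on_powr') auto
    fix x assume "x \<in> {a<..<b}"
    then have "x < 1" using ab by auto
    then have "((\<lambda>x. - ((1 - x) powr s)) has_real_derivative s * (1 - x) powr (s - 1)) (at x)"
      by (auto intro!: derivative_eq_intros)
    then show "((\<lambda>x. - ((1 - x) powr s)) has_vector_derivative s * (1 - x) powr (s - 1)) (at x)"
      by (simp add: has_real_derivative_iff_has_vector_derivative)
  qed
  then show ?thesis by simp
qed

lemma nn_integral_beta1_kernel:
  fixes s :: real
  assumes "s > 0" and "0 \<le> a" "a \<le> b" "b \<le> 1"
  shows "(\<integral>\<^sup>+x. ennreal (s * (1 - x) powr (s - 1)) * indicator {a..b} x \<partial>lborel)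
       = ennreal ((1 - a) powr s - (1 - b) powr s)"
  using assms by (intro nn_integral_has_integral_lebesgue' has_integral_beta1_kernel) auto

locale beta1_sequence = prob_space M for M :: "'w measure" +
  fixes U :: "nat \<Rightarrow> 'w \<Rightarrow> real" and \<theta> :: real
  assumes \<theta>_pos: "\<theta> > 0"
    and indep: "indep_vars (\<lambda>_. borel) U UNIV"
    and beta1: "\<And>k. distributed M lborel (U k) (\<lambda>x. ennreal (beta1_density \<theta> x))"
begin

lemma measurable_U [measurable]: "U k \<in> borel_measurable M"
  using beta1[of k] by (simp add: distributed_def)

lemma AE_beta1_density:
  "AE x in lborel. ennreal (beta1_density \<theta> x) * indicator {a..b} x
     = ennreal (\<theta> * (1 - x) powr (\<theta> - 1)) * indicator ({a..b} \<inter> {0..1}) x"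
proof -
  have "AE x in lborel. x \<noteq> (0::real) \<and> x \<noteq> (1::real)"
    using AE_lborel_singleton[of "0::real"] AE_lborel_singleton[of "1::real"] by eventually_elim auto
  then show ?thesis
    by eventually_elim (auto simp: beta1_density_def indicator_def)
qed

lemma prob_U_Icc:
  assumes "0 \<le> a" "a \<le> b" "b \<le> 1"
  shows "prob (U k -` {a..b} \<inter> space M) = (1 - a) powr \<theta> - (1 - b) powr \<theta>"
proof -
  have "emeasure M (U k -` {a..b} \<inter> space M)
      = (\<integral>\<^sup>+x. ennreal (beta1_density \<theta> x) * indicator {a..b} x \<partial>lborel)"
    by (rule distributed_emeasure[OF beta1]) simp
  also have "\<dots> = (\<integral>\<^sup>+x. ennreal (\<theta> * (1 - x) powr (\<theta> - 1)) * indicator ({a..b} \<inter> {0..1}) x \<partial>lborel)"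
    by (rule nn_integral_cong_AE) (rule AE_beta1_density)
  also have "{a..b} \<inter> {0..1} = {a..b}" using assms by auto
  also have "(\<integral>\<^sup>+x. ennreal (\<theta> * (1 - x) powr (\<theta> - 1)) * indicator {a..b} x \<partial>lborel)
      = ennreal ((1 - a) powr \<theta> - (1 - b) powr \<theta>)"
    by (rule nn_integral_beta1_kernel[OF \<theta>_pos assms])
  finally show ?thesis
    using assms \<theta>_pos by (simp add: emeasure_eq_measure powr_mono2)
qed

lemma AE_U: "AE \<omega> in M. \<forall>k. U k \<omega> \<in> {0<..<1}"
proof (subst AE_all_countable, rule allI)
  fix k
  have "AE x in density lborel (\<lambda>x. ennreal (beta1_density \<theta> x)). x \<in> {0<..<1}"
    using distributed_borel_measurable[OF beta1[of k]]
    by (subst AE_density) (auto simp: beta1_density_def)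
  then have "AE x in distr M lborel (U k). x \<in> {0<..<1}"
    unfolding distributed_distr_eq_density[OF beta1] .
  then show "AE \<omega> in M. U k \<omega> \<in> {0<..<1}"
    by (subst (asm) AE_distr_iff) auto
qed

lemma nn_integral_one_minus_U_powr:
  assumes "\<theta> + t > 0"
  shows "(\<integral>\<^sup>+\<omega>. ennreal ((1 - U k \<omega>) powr t) \<partial>M) = ennreal (\<theta> / (\<theta> + t))"
proof -
  have "(\<integral>\<^sup>+\<omega>. ennreal ((1 - U k \<omega>) powr t) \<partial>M)
      = (\<integral>\<^sup>+x. ennreal (beta1_density \<theta> x) * ennreal ((1 - x) powr t) \<partial>lborel)"
    by (rule distributed_nn_integral[OF beta1, symmetric]) simp
  also have "\<dots> = (\<integral>\<^sup>+x. ennreal (\<theta> / (\<theta> + t)) *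
      (ennreal ((\<theta> + t) * (1 - x) powr (\<theta> + t - 1)) * indicator {0..1} x) \<partial>lborel)"
  proof (rule nn_integral_cong_AE)
    have "AE x in lborel. x \<noteq> (0::real) \<and> x \<noteq> (1::real)"
      using AE_lborel_singleton[of "0::real"] AE_lborel_singleton[of "1::real"] by eventually_elim auto
    then show "AE x in lborel. ennreal (beta1_density \<theta> x) * ennreal ((1 - x) powr t)
        = ennreal (\<theta> / (\<theta> + t)) * (ennreal ((\<theta> + t) * (1 - x) powr (\<theta> + t - 1)) * indicator {0..1} x)"
    proof eventually_elim
      case (elim x)
      show ?case
      proof (cases "x \<in> {0<..<1}")
        case True
        have "\<theta> + t - 1 = (\<theta> - 1) + t" by simp
        then have "(1 - x) powr (\<theta> + t - 1) = (1 - x) powr (\<theta> - 1) * (1 - x) powr t"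
          by (simp only: powr_add)
        then have "\<theta> * (1 - x) powr (\<theta> - 1) * (1 - x) powr t
            = \<theta> / (\<theta> + t) * ((\<theta> + t) * (1 - x) powr (\<theta> + t - 1))"
          using assms by simp
        then show ?thesis
          using True \<theta>_pos assms by (simp add: beta1_density_def ennreal_mult[symmetric])
      qed (use elim in \<open>auto simp: beta1_density_def indicator_def\<close>)
    qed
  qed
  also have "\<dots> = ennreal (\<theta> / (\<theta> + t)) * ennreal 1"
    using nn_integral_beta1_kernel[OF assms, of 0 1] assms
    by (subst nn_integral_cmult) auto
  finally show ?thesis by simp
qed

lemma prob_prod_powr_ge:
  assumes I: "finite I" and t: "\<theta> + t > 0" and c: "c > 0"
  shows "prob {\<omega> \<in> space M. (\<Prod>i\<in>I. (1 - U i \<omega>) powr t) \<ge> c} \<le> (\<theta> / (\<theta> + t)) ^ card I / c"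
proof -
  let ?V = "\<lambda>\<omega>. \<Prod>i\<in>I. ennreal ((1 - U i \<omega>) powr t)"
  have V: "?V \<omega> = ennreal (\<Prod>i\<in>I. (1 - U i \<omega>) powr t)" for \<omega>
    by (simp add: prod_ennreal)
  have "{\<omega> \<in> space M. (\<Prod>i\<in>I. (1 - U i \<omega>) powr t) \<ge> c} = {\<omega> \<in> space M. 1 \<le> ennreal (1 / c) * ?V \<omega>}"
    using c by (auto simp: V ennreal_mult[symmetric] prod_nonneg field_simps
        ennreal_1[symmetric] simp del: ennreal_1)
  then have "emeasure M {\<omega> \<in> space M. (\<Prod>i\<in>I. (1 - U i \<omega>) powr t) \<ge> c}
      \<le> ennreal (1 / c) * (\<integral>\<^sup>+\<omega>. ?V \<omega> * indicator (space M) \<omega> \<partial>M)"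
    using nn_integral_Markov_inequality[of ?V "space M" M "ennreal (1 / c)"] by simp
  also have "(\<integral>\<^sup>+\<omega>. ?V \<omega> * indicator (space M) \<omega> \<partial>M) = (\<integral>\<^sup>+\<omega>. ?V \<omega> \<partial>M)"
    by (intro nn_integral_cong) simp
  also have "\<dots> = (\<Prod>i\<in>I. \<integral>\<^sup>+\<omega>. ennreal ((1 - U i \<omega>) powr t) \<partial>M)"
  proof (rule indep_vars_nn_integral[OF I])
    show "indep_vars (\<lambda>_. borel) (\<lambda>i \<omega>. ennreal ((1 - U i \<omega>) powr t)) I"
      by (rule indep_vars_compose2[OF indep_vars_subset[OF indep]]) auto
  qed simp
  also have "\<dots> = ennreal ((\<theta> / (\<theta> + t)) ^ card I)"
    using t \<theta>_pos by (simp add: nn_integral_one_minus_U_powr ennreal_power)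
  finally show ?thesis
    using c t \<theta>_pos by (simp add: emeasure_eq_measure ennreal_mult[symmetric] field_simps)
qed

text \<open>
  The moment of order \<open>\<theta>\<close> of each factor is \<open>1 / 2\<close>, so a number of factors proportional to \<open>\<theta>\<close>
  beats the factor \<open>c\<^bsup>- \<theta>\<^esup>\<close>.
\<close>

lemma prob_prod_ge:
  assumes I: "finite I" and c: "c > 0"
  shows "prob {\<omega> \<in> space M. (\<Prod>i\<in>I. 1 - U i \<omega>) \<ge> c} \<le> (1 / 2) ^ card I / c powr \<theta>"
proof -
  have "prob {\<omega> \<in> space M. (\<Prod>i\<in>I. 1 - U i \<omega>) \<ge> c}
      \<le> prob {\<omega> \<in> space M. (\<Prod>i\<in>I. (1 - U i \<omega>) powr \<theta>) \<ge> c powr \<theta>}"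
  proof (rule finite_measure_mono_AE)
    show "AE \<omega> in M. \<omega> \<in> {\<omega> \<in> space M. (\<Prod>i\<in>I. 1 - U i \<omega>) \<ge> c} \<longrightarrow>
        \<omega> \<in> {\<omega> \<in> space M. (\<Prod>i\<in>I. (1 - U i \<omega>) powr \<theta>) \<ge> c powr \<theta>}"
      using AE_U
    proof eventually_elim
      case (elim \<omega>)
      then have "(\<Prod>i\<in>I. (1 - U i \<omega>) powr \<theta>) = (\<Prod>i\<in>I. 1 - U i \<omega>) powr \<theta>"
        by (intro prod_powr_distrib[symmetric])
      then show ?case using c \<theta>_pos by (auto intro: powr_mono2)
    qed
  qed simp
  also have "\<dots> \<le> (\<theta> / (\<theta> + \<theta>)) ^ card I / c powr \<theta>"
    using \<theta>_pos c by (intro prob_prod_powr_ge I) auto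
  finally show ?thesis using \<theta>_pos by simp
qed

text \<open>
  The moment of order \<open>1 - \<theta>\<close> is just inside the range of finite moments, and it gives the exponent
  \<open>\<theta> - 1\<close> at the polynomial price \<open>\<theta>\<close> per factor.
\<close>

lemma prob_prod_le:
  assumes I: "finite I" and c: "c > 0" and \<theta>: "\<theta> \<ge> 1"
  shows "prob {\<omega> \<in> space M. (\<Prod>i\<in>I. 1 - U i \<omega>) \<le> c} \<le> \<theta> ^ card I * c powr (\<theta> - 1)"
proof -
  have "prob {\<omega> \<in> space M. (\<Prod>i\<in>I. 1 - U i \<omega>) \<le> c}
      \<le> prob {\<omega> \<in> space M. (\<Prod>i\<in>I. (1 - U i \<omega>) powr (1 - \<theta>)) \<ge> c powr (1 - \<theta>)}"
  proof (rule finite_measure_mono_AE)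
    show "AE \<omega> in M. \<omega> \<in> {\<omega> \<in> space M. (\<Prod>i\<in>I. 1 - U i \<omega>) \<le> c} \<longrightarrow>
        \<omega> \<in> {\<omega> \<in> space M. (\<Prod>i\<in>I. (1 - U i \<omega>) powr (1 - \<theta>)) \<ge> c powr (1 - \<theta>)}"
      using AE_U
    proof eventually_elim
      case (elim \<omega>)
      then have "(\<Prod>i\<in>I. (1 - U i \<omega>) powr (1 - \<theta>)) = (\<Prod>i\<in>I. 1 - U i \<omega>) powr (1 - \<theta>)"
        by (intro prod_powr_distrib[symmetric])
      moreover have "0 < (\<Prod>i\<in>I. 1 - U i \<omega>)"
        using elim by (intro prod_pos) auto
      ultimately show ?case using \<theta> by (auto intro: powr_mono2')
    qed
  qed simp
  also have "\<dots> \<le> (\<theta> / (\<theta> + (1 - \<theta>))) ^ card I / c powr (1 - \<theta>)"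
    using c by (intro prob_prod_powr_ge I) auto
  also have "\<dots> = \<theta> ^ card I * c powr (\<theta> - 1)"
    using powr_minus_divide[of c "1 - \<theta>"] by simp
  finally show ?thesis .
qed


section \<open>The law of the largest pieces\<close>

abbreviation largest :: "nat \<Rightarrow> 'w \<Rightarrow> nat \<Rightarrow> real" where
  "largest n \<omega> \<equiv> top_PD n (\<lambda>j. U j \<omega>)"

lemma measurable_largest [measurable]: "largest n \<in> borel_measurable M"
  by (rule measurable_top_PD) measurable

lemma AE_largest_in_nabla: "AE \<omega> in M. largest n \<omega> \<in> nabla n"
  using AE_U by eventually_elim (auto intro: top_PD_in_nabla)

lemma Xi_prob_space: "prob_space (Xi n M U)"
  and space_Xi: "space (Xi n M U) = nabla n"
  and sets_Xi: "sets (Xi n M U) = sets (restrict_space borel (nabla n))"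
proof -
  interpret D: prob_space "distr M borel (largest n)"
    by (rule prob_space_distr) measurable
  show "sets (Xi n M U) = sets (restrict_space borel (nabla n))" "space (Xi n M U) = nabla n"
    by (simp_all add: Xi_def sets_restrict_space space_restrict_space)
  have "AE p in distr M borel (largest n). p \<in> nabla n"
    using AE_largest_in_nabla by (subst AE_distr_iff) auto
  then show "prob_space (Xi n M U)"
    unfolding Xi_def by (intro prob_space_restrict_space D.emeasure_eq_1_AE) auto
qed

lemma measure_Xi:
  assumes "A \<in> sets borel" "A \<subseteq> nabla n"
  shows "measure (Xi n M U) A = prob {\<omega> \<in> space M. largest n \<omega> \<in> A}"
  using assms unfolding Xi_def
  by (subst measure_restrict_space) (auto simp: measure_distr vimage_def Int_def conj_commute)


section \<open>Estimates for fixed parameter\<close>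

text \<open>
  Union bound over the sets of \<open>n\<close> indices below \<open>K\<close>, with an error event for the remainder of the
  stick after \<open>K\<close> breaks.
\<close>

lemma prob_sum_largest_ge:
  assumes K: "n \<le> K" and \<epsilon>: "\<epsilon> > 0" and \<eta>: "\<eta> > 0" and \<theta>: "\<theta> \<ge> 1"
  shows "prob {\<omega> \<in> space M. (\<Sum>i<n. largest n \<omega> i) \<ge> 1 - \<eta> + \<epsilon>}
    \<le> (1 / 2) ^ K / \<epsilon> powr \<theta> + real K ^ n * (\<theta> ^ n * \<eta> powr (\<theta> - 1))"
proof -
  let ?\<I> = "{I. I \<subseteq> {..<K} \<and> card I = n}"
  let ?tail = "{\<omega> \<in> space M. (\<Prod>i<K. 1 - U i \<omega>) \<ge> \<epsilon>}"
  let ?small = "\<lambda>I. {\<omega> \<in> space M. (\<Prod>i\<in>I. 1 - U i \<omega>) \<le> \<eta>}"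
  have fin: "finite ?\<I>" by (rule finite_subset[of _ "Pow {..<K}"]) auto
  have finI: "finite I" if "I \<in> ?\<I>" for I using that finite_subset by blast
  have "prob {\<omega> \<in> space M. (\<Sum>i<n. largest n \<omega> i) \<ge> 1 - \<eta> + \<epsilon>} \<le> prob (?tail \<union> (\<Union>I\<in>?\<I>. ?small I))"
  proof (rule finite_measure_mono_AE)
    show "AE \<omega> in M. \<omega> \<in> {\<omega> \<in> space M. (\<Sum>i<n. largest n \<omega> i) \<ge> 1 - \<eta> + \<epsilon>} \<longrightarrow>
        \<omega> \<in> ?tail \<union> (\<Union>I\<in>?\<I>. ?small I)"
      using AE_U
    proof eventually_elim
      case (elim \<omega>)
      then obtain I where "I \<in> ?\<I>"
        "(\<Sum>i<n. largest n \<omega> i) \<le> 1 - (\<Prod>i\<in>I. 1 - U i \<omega>) + (\<Prod>j<K. 1 - U j \<omega>)"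
        using top_PD_sum_le[of "\<lambda>j. U j \<omega>", OF _ K] by auto
      then show ?case by force
    qed
    show "?tail \<union> (\<Union>I\<in>?\<I>. ?small I) \<in> events"
      by (intro sets.Un sets.finite_UN fin) measurable
  qed
  also have "\<dots> \<le> prob ?tail + prob (\<Union>I\<in>?\<I>. ?small I)"
    by (intro measure_Un_le sets.finite_UN fin) measurable
  also have "prob (\<Union>I\<in>?\<I>. ?small I) \<le> (\<Sum>I\<in>?\<I>. prob (?small I))"
    by (intro finite_measure_subadditive_finite fin) auto
  also have "\<dots> \<le> (\<Sum>I\<in>?\<I>. \<theta> ^ n * \<eta> powr (\<theta> - 1))"
    using prob_prod_le[OF finI \<eta> \<theta>] by (intro sum_mono) auto
  also have "\<dots> = real (K choose n) * (\<theta> ^ n * \<eta> powr (\<theta> - 1))"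
    using n_subsets[of "{..<K}" n] by simp
  also have "\<dots> \<le> real (K ^ n) * (\<theta> ^ n * \<eta> powr (\<theta> - 1))"
    using binomial_le_pow[OF K] \<theta> by (intro mult_right_mono) (auto simp del: of_nat_power)
  also have "prob ?tail \<le> (1 / 2) ^ K / \<epsilon> powr \<theta>"
    using prob_prod_ge[of "{..<K}", OF _ \<epsilon>] by simp
  finally show ?thesis by simp
qed

text \<open>
  The union bound is over \<open>L\<close> breaks. The first error term is negligible for fixed \<open>\<delta>\<close>, and the
  second one is negligible when \<open>L\<close> is a large multiple of \<open>\<theta>\<close>.
\<close>

lemma prob_tail_small:
  assumes \<delta>: "0 < \<delta>" "\<delta> < 1"
  shows "prob {\<omega> \<in> space M. (\<forall>k\<in>{n..<n + L}. U k \<omega> \<le> \<delta>) \<and> (\<Prod>j\<in>{n..<n + L}. 1 - U j \<omega>) \<le> \<delta>}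
    \<ge> 1 - real L * (1 - \<delta>) powr \<theta> - (1 / 2) ^ L / \<delta> powr \<theta>"
proof -
  let ?J = "{n..<n + L}"
  let ?good = "{\<omega> \<in> space M. (\<forall>k\<in>?J. U k \<omega> \<le> \<delta>) \<and> (\<Prod>j\<in>?J. 1 - U j \<omega>) \<le> \<delta>}"
  let ?big = "\<lambda>k. {\<omega> \<in> space M. U k \<omega> \<notin> {0..\<delta>}}"
  let ?left = "{\<omega> \<in> space M. (\<Prod>j\<in>?J. 1 - U j \<omega>) \<ge> \<delta>}"
  have big: "prob (?big k) = (1 - \<delta>) powr \<theta>" for k
  proof -
    have "prob (?big k) = prob (space M - U k -` {0..\<delta>} \<inter> space M)"
      by (intro arg_cong[where f = prob]) auto
    also have "\<dots> = (1 - \<delta>) powr \<theta>"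
      using prob_U_Icc[of 0 \<delta> k] \<delta> by (subst prob_compl) auto
    finally show ?thesis .
  qed
  have "1 - prob ?good = prob (space M - ?good)"
    by (subst prob_compl) auto
  also have "\<dots> \<le> prob ((\<Union>k\<in>?J. ?big k) \<union> ?left)"
    by (intro finite_measure_mono) auto
  also have "\<dots> \<le> prob (\<Union>k\<in>?J. ?big k) + prob ?left"
    by (intro measure_Un_le) auto
  also have "prob (\<Union>k\<in>?J. ?big k) \<le> (\<Sum>k\<in>?J. prob (?big k))"
    by (intro finite_measure_subadditive_finite) auto
  also have "(\<Sum>k\<in>?J. prob (?big k)) = real L * (1 - \<delta>) powr \<theta>"
    unfolding big by simp
  also have "prob ?left \<le> (1 / 2) ^ L / \<delta> powr \<theta>"
    using prob_prod_ge[of ?J \<delta>] \<delta> by simp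
  finally show ?thesis by simp
qed

text \<open>
  Intervals of length \<open>h * (1 - q j)\<close> have a right end point whose complement is
  \<open>(1 - q j) * (1 - h)\<close>. The probabilities then factor exactly, with a correction that does not
  depend on \<open>q\<close>.
\<close>

lemma prob_box:
  assumes q: "\<And>j. q j \<in> {0..<1}" and h: "0 \<le> h" "h \<le> 1"
  shows "prob {\<omega> \<in> space M. \<forall>j<n. U j \<omega> \<in> {q j..q j + h * (1 - q j)}}
    = (\<Prod>j<n. 1 - q j) powr \<theta> * (1 - (1 - h) powr \<theta>) ^ n"
proof (cases "n = 0")
  case False
  let ?B = "\<lambda>j. {q j..q j + h * (1 - q j)}"
  have one: "prob (U j -` ?B j \<inter> space M) = (1 - q j) powr \<theta> * (1 - (1 - h) powr \<theta>)" for j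
  proof -
    have le: "q j + h * (1 - q j) \<le> 1"
    proof -
      have "h * (1 - q j) \<le> 1 - q j"
        using h q[of j] by (intro mult_left_le_one_le) auto
      then show ?thesis by linarith
    qed
    have "(1 - q j) * (1 - h) = 1 - (q j + h * (1 - q j))" by (simp add: algebra_simps)
    then have "prob (U j -` ?B j \<inter> space M) = (1 - q j) powr \<theta> - ((1 - q j) * (1 - h)) powr \<theta>"
      using q[of j] h le by (simp only:) (rule prob_U_Icc, auto)
    also have "((1 - q j) * (1 - h)) powr \<theta> = (1 - q j) powr \<theta> * (1 - h) powr \<theta>"
      by (rule powr_mult)
    finally show ?thesis by (simp only: right_diff_distrib mult_1_right)
  qed
  have "prob {\<omega> \<in> space M. \<forall>j<n. U j \<omega> \<in> ?B j} = prob (\<Inter>j\<in>{..<n}. U j -` ?B j \<inter> space M)"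
    using False by (intro arg_cong[where f = prob]) auto
  also have "\<dots> = (\<Prod>j<n. prob (U j -` ?B j \<inter> space M))"
    using False by (intro indep_varsD[OF indep]) auto
  also have "\<dots> = (\<Prod>j<n. 1 - q j) powr \<theta> * (1 - (1 - h) powr \<theta>) ^ n"
    unfolding one by (simp add: prod.distrib prod_powr_distrib)
  finally show ?thesis .
qed (simp add: prob_space)

text \<open>
  The first \<open>n\<close> breaks are independent of the following \<open>L\<close>, so the two events of
  \<open>prob_box\<close> and \<open>prob_tail_small\<close> have a product probability.
\<close>

lemma prob_largest_close:
  assumes p: "p \<in> nabla n" "(\<Sum>i<n. p i) < 1" and \<delta>: "0 < \<delta>" "\<delta> < 1" and n: "n > 0"
  shows "prob {\<omega> \<in> space M. \<forall>i. \<bar>largest n \<omega> i - p i\<bar> \<le> \<delta>}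
    \<ge> (1 - (\<Sum>i<n. p i)) powr \<theta> * (1 - (1 - \<delta> / n) powr \<theta>) ^ n *
      (1 - real L * (1 - \<delta>) powr \<theta> - (1 / 2) ^ L / \<delta> powr \<theta>)"
proof -
  define q where "q = breaking_proportion p"
  define h where "h = \<delta> / n"
  have q: "q j \<in> {0..<1}" for j
    using breaking_proportion_bounds[OF p] by (auto simp: q_def)
  have h: "0 \<le> h" "h \<le> 1"
    using \<delta> n by (auto simp: h_def field_simps)
  let ?N = "{..<n}" and ?J = "{n..<n + L}"
  define A where "A = {x \<in> space (PiM ?N (\<lambda>_. borel)). \<forall>j\<in>?N. x j \<in> {q j..q j + h * (1 - q j)}}"
  define B where "B = {x \<in> space (PiM ?J (\<lambda>_. borel)).
    (\<forall>k\<in>?J. x k \<le> \<delta>) \<and> (\<Prod>j\<in>?J. 1 - x j) \<le> \<delta>}"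
  have [measurable]: "A \<in> sets (PiM ?N (\<lambda>_. borel))" "B \<in> sets (PiM ?J (\<lambda>_. borel))"
    unfolding A_def B_def by measurable
  let ?X = "\<lambda>\<omega>. restrict (\<lambda>i. U i \<omega>) ?N" and ?Y = "\<lambda>\<omega>. restrict (\<lambda>i. U i \<omega>) ?J"
  let ?box = "{\<omega> \<in> space M. \<forall>j<n. U j \<omega> \<in> {q j..q j + h * (1 - q j)}}"
  let ?tail = "{\<omega> \<in> space M. (\<forall>k\<in>?J. U k \<omega> \<le> \<delta>) \<and> (\<Prod>j\<in>?J. 1 - U j \<omega>) \<le> \<delta>}"
  have X: "?X -` A \<inter> space M = ?box"
    by (auto simp: A_def space_PiM)
  have Y: "?Y -` B \<inter> space M = ?tail"
    by (auto simp: B_def space_PiM)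
  have box: "prob ?box = (1 - (\<Sum>i<n. p i)) powr \<theta> * (1 - (1 - h) powr \<theta>) ^ n"
    using prob_box[of q h n, OF q h] prod_breaking_proportion[OF p, of n] by (simp add: q_def)
  have "(1 - (\<Sum>i<n. p i)) powr \<theta> * (1 - (1 - h) powr \<theta>) ^ n *
      (1 - real L * (1 - \<delta>) powr \<theta> - (1 / 2) ^ L / \<delta> powr \<theta>) \<le> prob ?box * prob ?tail"
    unfolding box[symmetric] by (intro mult_left_mono prob_tail_small[OF \<delta>]) simp
  also have "\<dots> = prob ((\<lambda>\<omega>. (?X \<omega>, ?Y \<omega>)) -` (A \<times> B) \<inter> space M)"
    unfolding X[symmetric] Y[symmetric]
    by (rule indep_varD[OF indep_var_restrict[OF indep], symmetric]) auto
  also have "\<dots> \<le> prob {\<omega> \<in> space M. \<forall>i. \<bar>largest n \<omega> i - p i\<bar> \<le> \<delta>}"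
  proof (rule finite_measure_mono_AE)
    have meas: "(\<lambda>\<omega>. largest n \<omega> i) \<in> borel_measurable M" for i
      using measurable_largest[of n] by (rule measurable_product_then_coordinatewise)
    show "{\<omega> \<in> space M. \<forall>i. \<bar>largest n \<omega> i - p i\<bar> \<le> \<delta>} \<in> events"
      by (intro sets.sets_Collect_countable_All borel_measurable_le borel_measurable_abs
          borel_measurable_diff meas borel_measurable_const)
    show "AE \<omega> in M. \<omega> \<in> (\<lambda>\<omega>. (?X \<omega>, ?Y \<omega>)) -` (A \<times> B) \<inter> space M \<longrightarrow>
        \<omega> \<in> {\<omega> \<in> space M. \<forall>i. \<bar>largest n \<omega> i - p i\<bar> \<le> \<delta>}"
      using AE_U
    proof eventually_elim
      case (elim \<omega>)
      show ?case
      proof (intro impI CollectI conjI allI)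
        fix i assume "\<omega> \<in> (\<lambda>\<omega>. (?X \<omega>, ?Y \<omega>)) -` (A \<times> B) \<inter> space M"
        then have "\<omega> \<in> ?X -` A \<inter> space M" "\<omega> \<in> ?Y -` B \<inter> space M" by auto
        then have \<omega>: "\<omega> \<in> ?box" "\<omega> \<in> ?tail" unfolding X Y .
        show "\<bar>largest n \<omega> i - p i\<bar> \<le> \<delta>"
        proof (rule top_PD_close[where L = "n + L", OF _ p])
          fix j assume "j < n"
          then have "U j \<omega> \<in> {q j..q j + h * (1 - q j)}" using \<omega>(1) by auto
          moreover have "h * (1 - q j) \<le> h * 1"
            using q[of j] h by (intro mult_left_mono) auto
          ultimately show "\<bar>U j \<omega> - breaking_proportion p j\<bar> \<le> \<delta> / n"
            by (auto simp: q_def h_def)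
        qed (use \<omega>(2) elim in auto)
      qed auto
    qed
  qed
  finally show ?thesis by (simp add: h_def)
qed

end

section \<open>Logarithmic asymptotics\<close>

lemma power_times_exponential_tendsto_0:
  fixes r :: real
  assumes "0 < r" "r < 1"
  shows "((\<lambda>\<theta>. \<theta> ^ k * r powr \<theta>) \<longlongrightarrow> 0) at_top"
proof -
  define c where "c = - ln r"
  have c: "c > 0" using assms by (simp add: c_def)
  have "filterlim (\<lambda>\<theta>. c * \<theta>) at_top at_top"
    using c by (intro filterlim_tendsto_pos_mult_at_top[OF tendsto_const] filterlim_ident) auto
  then have "((\<lambda>\<theta>. (c * \<theta>) ^ k / exp (c * \<theta>)) \<longlongrightarrow> 0) at_top"
    by (rule filterlim_compose[OF tendsto_power_div_exp_0])
  then have "((\<lambda>\<theta>. (1 / c ^ k) * ((c * \<theta>) ^ k / exp (c * \<theta>))) \<longlongrightarrow> (1 / c ^ k) * 0) at_top"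
    by (intro tendsto_mult tendsto_const)
  moreover have "(1 / c ^ k) * ((c * \<theta>) ^ k / exp (c * \<theta>)) = \<theta> ^ k * r powr \<theta>" for \<theta>
  proof -
    have "r powr \<theta> = 1 / exp (c * \<theta>)"
      using assms by (simp add: powr_def c_def exp_minus inverse_eq_divide mult.commute)
    then show ?thesis using c by (simp add: power_mult_distrib)
  qed
  ultimately show ?thesis by simp
qed

lemma eventually_power_times_exponential_le:
  fixes r e :: real
  assumes "0 < r" "r < 1" "0 < e"
  shows "\<forall>\<^sub>F \<theta> in at_top. \<theta> ^ k * r powr \<theta> \<le> e"
  using order_tendstoD(2)[OF power_times_exponential_tendsto_0[OF assms(1,2), of k] assms(3)]
  by eventually_elim simp

text \<open>
  This fixes how many breaks are needed: the constant \<open>\<bar>log 2 x\<bar>\<close> per unit of \<open>\<theta>\<close> makes the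
  factor \<open>(1 / 2)\<^bsup>L\<^esup>\<close> of \<open>prob_prod_ge\<close> at most a prescribed exponential \<open>x\<^bsup>\<theta>\<^esup>\<close>.
\<close>

lemma half_power_le_powr:
  fixes x \<theta> :: real
  assumes "x > 0" "\<theta> > 0"
  shows "(1 / 2) ^ nat \<lceil>\<bar>log 2 x\<bar> * \<theta>\<rceil> \<le> x powr \<theta>"
proof -
  let ?L = "nat \<lceil>\<bar>log 2 x\<bar> * \<theta>\<rceil>"
  have "- log 2 x * \<theta> \<le> \<bar>log 2 x\<bar> * \<theta>"
    using assms by (intro mult_right_mono) auto
  also have "\<dots> \<le> real ?L" by (rule real_nat_ceiling_ge)
  finally have L: "- real ?L \<le> log 2 x * \<theta>" by simp
  have "(1 / 2) ^ ?L = (2::real) powr (- real ?L)"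
    by (simp add: powr_minus powr_realpow power_one_over inverse_eq_divide)
  also have "\<dots> \<le> 2 powr (log 2 x * \<theta>)"
    using L by (intro powr_mono) auto
  also have "\<dots> = x powr \<theta>"
    using assms by (simp add: powr_powr[symmetric])
  finally show ?thesis .
qed

lemma log_prob_mono:
  assumes "0 \<le> x" "x \<le> y"
  shows "log_prob x \<le> log_prob y"
  using assms by (auto simp: log_prob_def)

lemma scaled_log_tendsto:
  "((\<lambda>\<theta>. ereal (ln C / \<theta> + ln r)) \<longlongrightarrow> ereal (ln r)) at_top"
proof -
  have "((\<lambda>\<theta>. ln C / \<theta> + ln r) \<longlongrightarrow> 0 + ln r) at_top"
    by (intro tendsto_add tendsto_const tendsto_divide_0[OF tendsto_const] filterlim_at_top_imp_at_infinity filterlim_ident)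
  then show ?thesis by simp
qed

lemma scaled_log_prob_exponential:
  assumes "C > 0" "r > 0" "\<theta> > 0"
  shows "ereal (1 / \<theta>) * log_prob (C * r powr \<theta>) = ereal (ln C / \<theta> + ln r)"
  using assms by (simp add: log_prob_def ln_mult ln_powr field_simps)

lemma Limsup_log_prob_le:
  assumes C: "C > 0" and r: "r > 0"
    and P: "\<forall>\<^sub>F \<theta> in at_top. 0 \<le> P \<theta> \<and> P \<theta> \<le> C * r powr \<theta>"
  shows "Limsup at_top (\<lambda>\<theta>. ereal (1 / \<theta>) * log_prob (P \<theta>)) \<le> ereal (ln r)"
proof -
  have "\<forall>\<^sub>F \<theta> in at_top. ereal (1 / \<theta>) * log_prob (P \<theta>) \<le> ereal (ln C / \<theta> + ln r)"
    using P eventually_gt_at_top[of 0]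
  proof eventually_elim
    case (elim \<theta>)
    then show ?case
      using scaled_log_prob_exponential[OF C r, of \<theta>]
      by (metis ereal_mult_left_mono log_prob_mono zero_le_divide_1_iff ereal_less_eq(5) less_imp_le)
  qed
  then have "Limsup at_top (\<lambda>\<theta>. ereal (1 / \<theta>) * log_prob (P \<theta>))
      \<le> Limsup at_top (\<lambda>\<theta>. ereal (ln C / \<theta> + ln r))"
    by (rule Limsup_mono)
  also have "\<dots> = ereal (ln r)"
    by (intro lim_imp_Limsup scaled_log_tendsto) simp
  finally show ?thesis .
qed

lemma Liminf_log_prob_ge:
  assumes C: "C > 0" and r: "r > 0"
    and P: "\<forall>\<^sub>F \<theta> in at_top. C * r powr \<theta> \<le> P \<theta>"
  shows "ereal (ln r) \<le> Liminf at_top (\<lambda>\<theta>. ereal (1 / \<theta>) * log_prob (P \<theta>))"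
proof -
  have "\<forall>\<^sub>F \<theta> in at_top. ereal (ln C / \<theta> + ln r) \<le> ereal (1 / \<theta>) * log_prob (P \<theta>)"
    using P eventually_gt_at_top[of 0]
  proof eventually_elim
    case (elim \<theta>)
    have "0 \<le> C * r powr \<theta>" using C by simp
    then show ?case
      using elim scaled_log_prob_exponential[OF C r, of \<theta>]
      by (metis ereal_mult_left_mono log_prob_mono zero_le_divide_1_iff ereal_less_eq(5) less_imp_le)
  qed
  then have "Liminf at_top (\<lambda>\<theta>. ereal (ln C / \<theta> + ln r))
      \<le> Liminf at_top (\<lambda>\<theta>. ereal (1 / \<theta>) * log_prob (P \<theta>))"
    by (rule Liminf_mono)
  moreover have "Liminf at_top (\<lambda>\<theta>. ereal (ln C / \<theta> + ln r)) = ereal (ln r)"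
    by (intro lim_imp_Liminf scaled_log_tendsto) simp
  ultimately show ?thesis by simp
qed


section \<open>The rate function\<close>

lemma sum_nabla_nonneg: "p \<in> nabla n \<Longrightarrow> 0 \<le> (\<Sum>i<n. p i)"
  by (intro sum_nonneg) (auto simp: nabla_def)

lemma rate_S_le_iff:
  assumes "p \<in> nabla n"
  shows "rate_S n p \<le> ereal c \<longleftrightarrow> (\<Sum>i<n. p i) \<le> 1 - exp (- c)"
proof (cases "(\<Sum>i<n. p i) < 1")
  case True
  have "ln (1 / (1 - (\<Sum>i<n. p i))) \<le> c \<longleftrightarrow> - c \<le> ln (1 - (\<Sum>i<n. p i))"
    using True by (auto simp: ln_div)
  also have "\<dots> \<longleftrightarrow> exp (- c) \<le> 1 - (\<Sum>i<n. p i)"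
    using True by (simp add: ln_ge_iff)
  finally show ?thesis
    using assms True by (auto simp: rate_S_def)
next
  case False
  moreover have "\<not> (\<Sum>i<n. p i) \<le> 1 - exp (- c)"
    using False exp_gt_zero[of "- c"] by linarith
  ultimately show ?thesis by (simp add: rate_S_def)
qed

lemma rate_S_nonneg: "p \<in> nabla n \<Longrightarrow> 0 \<le> rate_S n p"
  using sum_nabla_nonneg[of p n] by (auto simp: rate_S_def ln_div)


section \<open>The large deviation principle\<close>

text \<open>
  The slack between \<open>1 - m\<close> and \<open>\<eta>\<close> is used twice: \<open>\<epsilon>\<close> accounts for the remainder of the stick, and
  the gap between \<open>\<eta>'\<close> and \<open>\<eta>\<close> absorbs the polynomial number of index sets.
\<close>

lemma Limsup_Xi_le:
  assumes seq: "\<And>\<theta>. \<theta> > 0 \<Longrightarrow> beta1_sequence (M \<theta>) (U \<theta>) \<theta>"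
    and F: "F \<in> sets borel" "F \<subseteq> {p \<in> nabla n. m \<le> (\<Sum>i<n. p i)}"
    and \<eta>: "0 < \<eta>" "1 - m < \<eta>"
  shows "Limsup at_top (\<lambda>\<theta>. ereal (1 / \<theta>) * log_prob (measure (Xi n (M \<theta>) (U \<theta>)) F)) \<le> ereal (ln \<eta>)"
proof -
  obtain \<eta>' where \<eta>': "max 0 (1 - m) < \<eta>'" "\<eta>' < \<eta>"
    using dense[of "max 0 (1 - m)" \<eta>] \<eta> by auto
  define \<epsilon> where "\<epsilon> = m - (1 - \<eta>')"
  have pos: "0 < \<eta>'" "0 < \<epsilon>" "0 < \<epsilon> * \<eta>'" and m: "m = 1 - \<eta>' + \<epsilon>"
    using \<eta>' by (auto simp: \<epsilon>_def)
  \<comment> \<open>With \<open>a * \<theta>\<close> breaks the remainder exceeds \<open>\<epsilon>\<close> with probability at most \<open>\<eta>'\<^bsup>\<theta>\<^esup>\<close>.\<close>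
  define a where "a = \<bar>log 2 (\<epsilon> * \<eta>')\<bar>"
  define b where "b = (a + n + 1) ^ n / \<eta>'"
  have a: "0 \<le> a" and b: "0 < b"
    using pos by (auto simp: a_def b_def intro!: divide_pos_pos zero_less_power)
  have "\<forall>\<^sub>F \<theta> in at_top. \<theta> ^ (2 * n) * (\<eta>' / \<eta>) powr \<theta> \<le> 1 / b"
    using \<eta>' \<eta> pos b by (intro eventually_power_times_exponential_le) auto
  then have "\<forall>\<^sub>F \<theta> in at_top. 0 \<le> measure (Xi n (M \<theta>) (U \<theta>)) F \<and>
      measure (Xi n (M \<theta>) (U \<theta>)) F \<le> 2 * \<eta> powr \<theta>"
    using eventually_ge_at_top[of 1]
  proof eventually_elim
    case (elim \<theta>)
    then have \<theta>: "\<theta> > 0" by simp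
    interpret beta1_sequence "M \<theta>" "U \<theta>" \<theta> by (rule seq[OF \<theta>])
    define L where "L = nat \<lceil>a * \<theta>\<rceil>"
    \<comment> \<open>The summand \<open>n\<close> ensures that there are sets of \<open>n\<close> indices below \<open>K\<close>.\<close>
    define K where "K = n + L"
    have "(1 / 2) ^ K \<le> ((1 / 2) ^ L :: real)"
      unfolding K_def by (intro power_decreasing) auto
    also have "\<dots> \<le> (\<epsilon> * \<eta>') powr \<theta>"
      unfolding L_def a_def by (rule half_power_le_powr) fact+
    also have "\<dots> = \<epsilon> powr \<theta> * \<eta>' powr \<theta>"
      using pos by (simp add: powr_mult)
    finally have "(1 / 2) ^ K / \<epsilon> powr \<theta> \<le> \<eta>' powr \<theta>"
      using pos by (simp add: field_simps)
    also have "\<dots> \<le> \<eta> powr \<theta>"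
      using pos \<eta>' \<theta> by (intro powr_mono2) auto
    finally have 1: "(1 / 2) ^ K / \<epsilon> powr \<theta> \<le> \<eta> powr \<theta>" .
    have "real K \<le> n + (a * \<theta> + 1)"
      using a \<theta> unfolding K_def L_def by (simp add: of_nat_ceiling)
    also have "\<dots> \<le> real n * \<theta> + (a * \<theta> + 1 * \<theta>)"
      using elim mult_left_mono[of 1 \<theta> "real n"] by simp
    finally have "real K \<le> (a + n + 1) * \<theta>" by (simp add: algebra_simps)
    then have "real K ^ n \<le> ((a + n + 1) * \<theta>) ^ n"
      by (intro power_mono) auto
    then have "real K ^ n * (\<theta> ^ n * \<eta>' powr (\<theta> - 1)) \<le> ((a + n + 1) * \<theta>) ^ n * (\<theta> ^ n * \<eta>' powr (\<theta> - 1))"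
      using \<theta> by (intro mult_right_mono) auto
    also have "\<dots> = b * (\<theta> ^ (2 * n) * (\<eta>' / \<eta>) powr \<theta>) * \<eta> powr \<theta>"
      using pos \<eta> by (simp add: b_def powr_diff powr_divide power_mult_distrib mult_2 power_add)
    also have "\<dots> \<le> b * (1 / b) * \<eta> powr \<theta>"
      using b elim by (intro mult_right_mono mult_left_mono) auto
    finally have 2: "real K ^ n * (\<theta> ^ n * \<eta>' powr (\<theta> - 1)) \<le> \<eta> powr \<theta>"
      using b by simp
    have "measure (Xi n (M \<theta>) (U \<theta>)) F = prob {\<omega> \<in> space (M \<theta>). largest n \<omega> \<in> F}"
      using F by (intro measure_Xi) auto
    also have "\<dots> \<le> prob {\<omega> \<in> space (M \<theta>). (\<Sum>i<n. largest n \<omega> i) \<ge> 1 - \<eta>' + \<epsilon>}"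
    proof (rule finite_measure_mono)
      have "(\<lambda>\<omega>. largest n \<omega> i) \<in> borel_measurable (M \<theta>)" for i
        using measurable_largest[of n] by (rule measurable_product_then_coordinatewise)
      then show "{\<omega> \<in> space (M \<theta>). (\<Sum>i<n. largest n \<omega> i) \<ge> 1 - \<eta>' + \<epsilon>} \<in> events"
        by (intro borel_measurable_le borel_measurable_sum borel_measurable_const)
    qed (use F(2) m in auto)
    also have "\<dots> \<le> (1 / 2) ^ K / \<epsilon> powr \<theta> + real K ^ n * (\<theta> ^ n * \<eta>' powr (\<theta> - 1))"
      using pos elim by (intro prob_sum_largest_ge) (auto simp: K_def)
    also have "\<dots> \<le> 2 * \<eta> powr \<theta>" using 1 2 by simp
    finally show ?case by simp
  qed
  then show ?thesis
    using \<eta>(1) by (intro Limsup_log_prob_le) auto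
qed

text \<open>
  In the bound of \<open>prob_largest_close\<close> the factors besides \<open>(1 - (\<Sum>i<n. p i))\<^bsup>\<theta>\<^esup>\<close> tend to 1
  for a suitable \<open>L\<close>, so they are eventually at least \<open>1 / 2\<close> each, which is invisible on the
  logarithmic scale.
\<close>

lemma Liminf_Xi_ge:
  assumes seq: "\<And>\<theta>. \<theta> > 0 \<Longrightarrow> beta1_sequence (M \<theta>) (U \<theta>) \<theta>" and n: "n > 0"
    and G: "openin (top_of_set (nabla n)) G" "G \<in> sets borel"
    and p: "p \<in> G" "(\<Sum>i<n. p i) < 1"
  shows "ereal (ln (1 - (\<Sum>i<n. p i)))
    \<le> Liminf at_top (\<lambda>\<theta>. ereal (1 / \<theta>) * log_prob (measure (Xi n (M \<theta>) (U \<theta>)) G))"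
proof -
  have sub: "G \<subseteq> nabla n" using openin_subset[OF G(1)] by simp
  obtain \<delta>0 where \<delta>0: "\<delta>0 > 0" "\<And>y. y \<in> nabla n \<Longrightarrow> (\<And>i. \<bar>y i - p i\<bar> \<le> \<delta>0) \<Longrightarrow> y \<in> G"
    using openin_nabla_contains_box[OF G(1) p(1)] by blast
  define \<delta> where "\<delta> = min \<delta>0 (1 / 2)"
  have \<delta>: "0 < \<delta>" "\<delta> < 1" "\<delta> \<le> \<delta>0" using \<delta>0(1) by (auto simp: \<delta>_def)
  define r where "r = 1 - (\<Sum>i<n. p i)"
  have r: "r > 0" using p(2) by (simp add: r_def)
  \<comment> \<open>The factor \<open>1 / 2\<close> leaves \<open>2\<^bsup>- \<theta>\<^esup>\<close> after division by \<open>\<delta>\<^bsup>\<theta>\<^esup>\<close>.\<close>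
  define a where "a = \<bar>log 2 (\<delta> / 2)\<bar>"
  have a: "0 \<le> a" by (simp add: a_def)
  have "\<delta> / n < 1" using \<delta> n by (simp add: field_simps)
  then have "\<forall>\<^sub>F \<theta> in at_top. \<theta> ^ 0 * (1 - \<delta> / n) powr \<theta> \<le> 1 / 2"
    using \<delta> n by (intro eventually_power_times_exponential_le) auto
  moreover have "\<forall>\<^sub>F \<theta> in at_top. \<theta> ^ 1 * (1 - \<delta>) powr \<theta> \<le> 1 / (4 * (a + 1))"
    using \<delta> a by (intro eventually_power_times_exponential_le) auto
  moreover have "\<forall>\<^sub>F \<theta> in at_top. \<theta> ^ 0 * (1 / 2) powr \<theta> \<le> (1 / 4 :: real)"
    by (intro eventually_power_times_exponential_le) auto
  ultimately have "\<forall>\<^sub>F \<theta> in at_top. (1 / 2) ^ Suc n * r powr \<theta> \<le> measure (Xi n (M \<theta>) (U \<theta>)) G"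
    using eventually_ge_at_top[of 1]
  proof eventually_elim
    case (elim \<theta>)
    then have \<theta>: "\<theta> > 0" by simp
    interpret beta1_sequence "M \<theta>" "U \<theta>" \<theta> by (rule seq[OF \<theta>])
    define L where "L = nat \<lceil>a * \<theta>\<rceil>"
    have "real L \<le> a * \<theta> + 1"
      using a \<theta> unfolding L_def by (simp add: of_nat_ceiling)
    also have "\<dots> \<le> (a + 1) * \<theta>" using elim by (simp add: algebra_simps)
    finally have "real L * (1 - \<delta>) powr \<theta> \<le> (a + 1) * \<theta> * (1 - \<delta>) powr \<theta>"
      by (intro mult_right_mono) auto
    also have "\<dots> = (a + 1) * (\<theta> ^ 1 * (1 - \<delta>) powr \<theta>)" by simp
    also have "\<dots> \<le> (a + 1) * (1 / (4 * (a + 1)))"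
      using a elim by (intro mult_left_mono) auto
    also have "\<dots> = 1 / 4" using a by (simp add: field_simps)
    finally have 1: "real L * (1 - \<delta>) powr \<theta> \<le> 1 / 4" .
    have "(1 / 2) ^ L \<le> (\<delta> / 2) powr \<theta>"
      unfolding L_def a_def using \<delta> \<theta> by (intro half_power_le_powr) auto
    also have "\<dots> = (1 / 2) powr \<theta> * \<delta> powr \<theta>"
      using \<delta> by (simp add: powr_divide)
    also have "\<dots> \<le> 1 / 4 * \<delta> powr \<theta>"
      using elim by (intro mult_right_mono) auto
    finally have 2: "(1 / 2) ^ L / \<delta> powr \<theta> \<le> 1 / 4"
      using \<delta> by (simp add: field_simps)
    have "(1 / 2) ^ Suc n * r powr \<theta> = r powr \<theta> * (1 / 2) ^ n * (1 / 2)" by simp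
    also have "\<dots> \<le> r powr \<theta> * (1 - (1 - \<delta> / n) powr \<theta>) ^ n *
        (1 - real L * (1 - \<delta>) powr \<theta> - (1 / 2) ^ L / \<delta> powr \<theta>)"
      using 1 2 elim by (intro mult_mono mult_left_mono power_mono) auto
    also have "\<dots> \<le> prob {\<omega> \<in> space (M \<theta>). \<forall>i. \<bar>largest n \<omega> i - p i\<bar> \<le> \<delta>}"
      unfolding r_def using p sub \<delta> n by (intro prob_largest_close) auto
    also have "\<dots> \<le> prob {\<omega> \<in> space (M \<theta>). largest n \<omega> \<in> G}"
    proof (rule finite_measure_mono_AE)
      show "AE \<omega> in M \<theta>. \<omega> \<in> {\<omega> \<in> space (M \<theta>). \<forall>i. \<bar>largest n \<omega> i - p i\<bar> \<le> \<delta>} \<longrightarrow>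
          \<omega> \<in> {\<omega> \<in> space (M \<theta>). largest n \<omega> \<in> G}"
        using AE_largest_in_nabla[of n]
        by eventually_elim (use \<delta>0(2) \<delta>(3) in \<open>auto intro: order_trans\<close>)
      show "{\<omega> \<in> space (M \<theta>). largest n \<omega> \<in> G} \<in> events"
        using measurable_sets[OF measurable_largest G(2)] by (simp add: vimage_def Int_def conj_commute)
    qed
    also have "\<dots> = measure (Xi n (M \<theta>) (U \<theta>)) G"
      using G(2) sub by (rule measure_Xi[symmetric])
    finally show ?case .
  qed
  then show ?thesis
    unfolding r_def[symmetric] by (intro Liminf_log_prob_ge[where C = "(1 / 2) ^ Suc n"] r) simp_all
qed

theorem theorem4p3:
  fixes n :: nat
    and M :: "real \<Rightarrow> 'w measure"
    and U :: "real \<Rightarrow> nat \<Rightarrow> 'w \<Rightarrow> real"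
  assumes "n \<ge> 2"
    and "\<And>\<theta>. \<theta> > 0 \<Longrightarrow> prob_space (M \<theta>)"
    and "\<And>\<theta>. \<theta> > 0 \<Longrightarrow> prob_space.indep_vars (M \<theta>) (\<lambda>_. borel) (U \<theta>) UNIV"
    and "\<And>\<theta> k. \<theta> > 0 \<Longrightarrow> distributed (M \<theta>) lborel (U \<theta> k) (\<lambda>x. ennreal (beta1_density \<theta> x))"
  shows "satisfies_LDP (nabla n) (\<lambda>\<theta>. Xi n (M \<theta>) (U \<theta>)) (rate_S n)"
proof -
  let ?Q = "\<lambda>\<theta>. Xi n (M \<theta>) (U \<theta>)" and ?I = "rate_S n"
  have seq: "beta1_sequence (M \<theta>) (U \<theta>) \<theta>" if "\<theta> > 0" for \<theta>
    using assms that by (simp add: beta1_sequence_def beta1_sequence_axioms_def)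
  have upper: "Limsup at_top (\<lambda>\<theta>. ereal (1 / \<theta>) * log_prob (measure (?Q \<theta>) F)) \<le> - (INF x\<in>F. ?I x)"
    (is "?L \<le> - ?m") if F: "closedin (top_of_set (nabla n)) F" for F
  proof -
    have sub: "F \<subseteq> nabla n" using closedin_subset[OF F] by simp
    have borel: "F \<in> sets borel"
      using closedin_closed_trans[OF F compact_imp_closed[OF compact_nabla]] by (rule borel_closed)
    have "?m \<le> - ?L"
    proof (rule dense_le)
      fix x assume x: "x < ?m"
      \<comment> \<open>\<open>Limsup_Xi_le\<close> needs room, so a second level \<open>c'\<close> is placed between \<open>x\<close> and the infimum.\<close>
      show "x \<le> - ?L"
      proof (cases "x \<le> 0")
        case True
        have "?L \<le> ereal (ln 1)"
        proof (rule Limsup_log_prob_le)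
          show "\<forall>\<^sub>F \<theta> in at_top. 0 \<le> measure (?Q \<theta>) F \<and> measure (?Q \<theta>) F \<le> 1 * 1 powr \<theta>"
            using eventually_gt_at_top[of 0]
          proof eventually_elim
            case (elim \<theta>)
            interpret Q: prob_space "?Q \<theta>"
              using seq[OF elim] by (rule beta1_sequence.Xi_prob_space)
            show ?case by simp
          qed
        qed simp_all
        then have "0 \<le> - ?L" by (simp add: ereal_uminus_le_reorder zero_ereal_def[symmetric])
        with True show ?thesis by (rule order_trans)
      next
        case False
        then obtain c where c: "x = ereal c" "c > 0"
          using x by (cases x) auto
        obtain c' where c': "x < ereal c'" "ereal c' < ?m"
          using ereal_dense2[OF x] by blast
        have "F \<subseteq> {p \<in> nabla n. 1 - exp (- c') \<le> (\<Sum>i<n. p i)}"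
        proof
          fix p assume p: "p \<in> F"
          then have "ereal c' < ?I p" using c'(2) by (meson INF_lower less_le_trans)
          then have "\<not> ?I p \<le> ereal c'" by simp
          then show "p \<in> {p \<in> nabla n. 1 - exp (- c') \<le> (\<Sum>i<n. p i)}"
            using p sub rate_S_le_iff[of p n c'] by auto
        qed
        moreover have "1 - (1 - exp (- c')) < exp (- c)" using c c' by simp
        ultimately have "?L \<le> ereal (ln (exp (- c)))"
          using borel by (intro Limsup_Xi_le[OF seq]) auto
        then have "?L \<le> - x" using c by simp
        then show ?thesis using ereal_uminus_le_reorder[of "- x" "- ?L"] by simp
      qed
    qed
    then show ?thesis using ereal_uminus_le_reorder[of "- ?m" "- ?L"] by simp
  qed
  have lower: "- (INF x\<in>G. ?I x) \<le> Liminf at_top (\<lambda>\<theta>. ereal (1 / \<theta>) * log_prob (measure (?Q \<theta>) G))"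
    (is "_ \<le> ?L") if G: "openin (top_of_set (nabla n)) G" for G
  proof -
    have sub: "G \<subseteq> nabla n" using openin_subset[OF G] by simp
    have borel: "G \<in> sets borel"
      using G by (auto simp: openin_open)
    have "- ?L \<le> ?I p" if p: "p \<in> G" for p
    proof (cases "(\<Sum>i<n. p i) < 1")
      case True
      then have eq: "?I p = - ereal (ln (1 - (\<Sum>i<n. p i)))"
        using p sub by (auto simp: rate_S_def ln_div)
      have "ereal (ln (1 - (\<Sum>i<n. p i))) \<le> ?L"
        using assms(1) by (intro Liminf_Xi_ge[OF seq _ G borel p True]) auto
      then show ?thesis
        unfolding eq by (simp only: ereal_minus_le_minus)
    qed (simp add: rate_S_def)
    then have "- ?L \<le> (INF x\<in>G. ?I x)" by (intro INF_greatest)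
    then show ?thesis by (simp add: ereal_uminus_le_reorder)
  qed
  have level: "compact {x \<in> nabla n. ?I x \<le> ereal c}" for c
  proof -
    have "{x \<in> nabla n. ?I x \<le> ereal c} = {x \<in> nabla n. (\<Sum>i<n. x i) \<le> 1 - exp (- c)}"
      using rate_S_le_iff by auto
    then show ?thesis using compact_nabla_sum_le by simp
  qed
  show ?thesis
    unfolding satisfies_LDP_def
  proof (intro conjI allI impI ballI)
    show "Topological_Spaces.complete (nabla n)"
      by (rule compact_imp_complete[OF compact_nabla])
  next
    fix \<theta> :: real assume "\<theta> > 0"
    then interpret beta1_sequence "M \<theta>" "U \<theta>" \<theta> by (rule seq)
    show "prob_space (?Q \<theta>)" "space (?Q \<theta>) = nabla n"
      "sets (?Q \<theta>) = sets (restrict_space borel (nabla n))"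
      by (rule Xi_prob_space space_Xi sets_Xi)+
  qed (rule level | erule rate_S_nonneg upper lower)+
qed

end
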